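(* Let $\lambda,\mu,T>0$ and $N\ge2$. Let $f_t^N$ and $\tilde f_t^N$ be the laws at time $t$ of the thermostated Kac $N$-particle systems starting from (possibly different) symmetric initial distributions $f_0^N$ and $\tilde f_0^N$ on $\mathbb{R}^N$, respectively. Then for all $t\ge0$ $$W_2^2(f_t^N,\tilde f_t^N)\le e^{-\frac{\mu}{2}t}\,W_2^2(f_0^N,\tilde f_0^N).$$ Consequently, taking $\tilde f_0^N$ to be the stationary distribution $\gamma^{\otimes N}$, for all $t\ge0$ $$W_2^2(f_t^N,\gamma^{\otimes N})\le e^{-\frac{\mu}{2}t}\,W_2^2(f_0^N,\gamma^{\otimes N}).$$
   Context: $\gamma(w)=(2\pi T)^{-1/2}e^{-w^2/(2T)}$ is the centered Gaussian density with variance $T$, also identified with the corresponding probability measure. "Symmetric" means invariant under permutations of coordinates. The thermostated Kac $N$-particle system is the $\mathbb{R}^N$-valued continuous-time pure-jump Markov process $\mathbf{V}_t=(V_t^1,\dots,V_t^N)$ with the following dynamics (all random choices are independent). (i) Kac collisions: at rate $\lambda N$, an ordered pair of distinct indices $(i,j)$ is chosen uniformly at random and $\theta\in[0,2\pi)$ is chosen uniformly; the velocities $(v,v_* )=(V^i,V^j)$ are replaced by $(v\cos\theta-v_*\sin\theta,\ v\sin\theta+v_*\cos\theta)$. (ii) Thermostat interactions: at rate $\mu N$, an index $i$ is chosen uniformly, $\theta\in[0,2\pi)$ is chosen uniformly, $w$ is sampled from the density $\gamma$, and $v=V^i$ is replaced by $v\cos\theta-w\sin\theta$. For probability measures $f,g$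 on $\mathbb{R}^k$, $$W_2(f,g)=\Big(\inf_{\mathbf{X},\mathbf{Y}}\mathbb{E}\Big[\frac1k\sum_{i=1}^k(X^i-Y^i)^2\Big]\Big)^{1/2},$$ the infimum being over all pairs of random vectors $\mathbf{X}=(X^1,\dots,X^k)$, $\mathbf{Y}=(Y^1,\dots,Y^k)$ with $\mathrm{Law}(\mathbf{X})=f$, $\mathrm{Law}(\mathbf{Y})=g$ (note the normalization $1/k$). $W_2^2(f,g)$ denotes $W_2(f,g)^2$. *)

theory Defs
  imports "HOL-Probability.Probability" "HOL-Combinatorics.Permutations"
begin

section \<open>The space \<open>\<real>\<^sup>k\<close>, symmetry, and the normalized Wasserstein distance\<close>

text \<open>Vectors in \<open>\<real>\<^sup>k\<close> are the extensional functions on \<open>{..<k}\<close>, so that product laws are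
  literally \<open>PiM\<close> measures; the coordinates are numbered from 0.\<close>

abbreviation euclid :: "nat \<Rightarrow> (nat \<Rightarrow> real) measure" where
  "euclid k \<equiv> PiM {..<k} (\<lambda>_. borel)"

definition symmetric_law :: "nat \<Rightarrow> (nat \<Rightarrow> real) measure \<Rightarrow> bool" where
  "symmetric_law k f \<longleftrightarrow> (\<forall>p. p permutes {..<k} \<longrightarrow> distr f (euclid k) (\<lambda>x. x \<circ> p) = f)"

text \<open>The joint laws of all pairs \<open>(X, Y)\<close> of random vectors, on arbitrary probability spaces,
  with \<open>Law X = f\<close> and \<open>Law Y = g\<close>. Every such law is realized by the two projections, so an
  infimum over these measures is an infimum over all pairs of random vectors.\<close>

definition couplings ::
    "nat \<Rightarrow> (nat \<Rightarrow> real) measure \<Rightarrow> (nat \<Rightarrow> real) measure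
      \<Rightarrow> ((nat \<Rightarrow> real) \<times> (nat \<Rightarrow> real)) measure set" where
  "couplings k f g = {P. prob_space P \<and> sets P = sets (euclid k \<Otimes>\<^sub>M euclid k) \<and>
      distr P (euclid k) fst = f \<and> distr P (euclid k) snd = g}"

definition ennreal_sqrt :: "ennreal \<Rightarrow> ennreal" where
  "ennreal_sqrt x = (if x = \<infinity> then \<infinity> else ennreal (sqrt (enn2real x)))"

lemma ennreal_sqrt_power2: "ennreal_sqrt x ^ 2 = x"
proof (cases x)
  case (real r)
  then show ?thesis
    by (simp add: ennreal_sqrt_def ennreal_power[of "sqrt r" 2])
next
  case top
  then show ?thesis
    by (simp add: ennreal_sqrt_def power2_eq_square ennreal_mult_eq_top_iff)
qed

text \<open>Laws with infinite second moment are allowed, hence the values in \<open>[0, \<infinity>]\<close>.\<close>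

definition W2 :: "nat \<Rightarrow> (nat \<Rightarrow> real) measure \<Rightarrow> (nat \<Rightarrow> real) measure \<Rightarrow> ennreal" where
  "W2 k f g = ennreal_sqrt (INF P \<in> couplings k f g.
      \<integral>\<^sup>+ (x, y). ennreal (1 / real k * (\<Sum>i<k. (x i - y i)\<^sup>2)) \<partial>P)"


section \<open>Pure-jump Markov processes\<close>

text \<open>\<open>K x B\<close> is the probability of a step from \<open>x\<close> into \<open>B\<close>; the equation says that, conditionally
  on \<open>Y 0, \<dots>, Y n\<close>, the law of \<open>Y (n + 1)\<close> is \<open>K (Y n)\<close>.\<close>

definition markov_chain ::
    "'a measure \<Rightarrow> 'x measure \<Rightarrow> ('x \<Rightarrow> 'x set \<Rightarrow> real) \<Rightarrow> (nat \<Rightarrow> 'a \<Rightarrow> 'x) \<Rightarrow> bool" where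
  "markov_chain M S K Y \<longleftrightarrow>
     (\<forall>n. Y n \<in> measurable M S) \<and>
     (\<forall>n. \<forall>A \<in> sets (PiM {..n} (\<lambda>_. S)). \<forall>B \<in> sets S.
        measure M {\<omega> \<in> space M. (\<lambda>k\<in>{..n}. Y k \<omega>) \<in> A \<and> Y (Suc n) \<omega> \<in> B} =
        (LINT \<omega>:{\<omega> \<in> space M. (\<lambda>k\<in>{..n}. Y k \<omega>) \<in> A}|M. K (Y n \<omega>) B))"

text \<open>Jump chain and holding times. Here \<open>q x B\<close> is the rate of jumps from \<open>x\<close> into \<open>B\<close>, for a
  measurable kernel \<open>q\<close> with positive and finite total rate \<open>c x = q x (space S)\<close>. The states
  visited form a Markov chain \<open>Y\<close> with kernel \<open>q x B / c x\<close>; given \<open>Y\<close>, the holding times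
  are independent, that in \<open>Y n\<close> being exponential with parameter \<open>c (Y n)\<close>, that is, equal to
  \<open>\<xi> n / c (Y n)\<close> with \<open>\<xi>\<close> i.i.d. standard exponential and independent of \<open>Y\<close>. As
  \<open>q x {x} > 0\<close> is permitted, a jump need not change the state. Nothing is required on the null
  set where the jump times accumulate.\<close>

definition jump_time ::
    "'x measure \<Rightarrow> ('x \<Rightarrow> 'x set \<Rightarrow> real) \<Rightarrow> (nat \<Rightarrow> 'a \<Rightarrow> 'x) \<Rightarrow> (nat \<Rightarrow> 'a \<Rightarrow> real)
      \<Rightarrow> nat \<Rightarrow> 'a \<Rightarrow> real" where
  "jump_time S q Y \<xi> n \<omega> = (\<Sum>k<n. \<xi> k \<omega> / q (Y k \<omega>) (space S))"

definition pure_jump_markov_process ::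
    "'a measure \<Rightarrow> 'x measure \<Rightarrow> ('x \<Rightarrow> 'x set \<Rightarrow> real) \<Rightarrow> (real \<Rightarrow> 'a \<Rightarrow> 'x) \<Rightarrow> bool" where
  "pure_jump_markov_process M S q V \<longleftrightarrow>
     prob_space M \<and>
     (\<forall>t\<ge>0. V t \<in> measurable M S) \<and>
     (\<exists>Y \<xi>. markov_chain M S (\<lambda>x B. q x B / q x (space S)) Y \<and>
        (\<forall>n. \<xi> n \<in> borel_measurable M) \<and>
        distr M (PiM UNIV (\<lambda>_. borel) \<Otimes>\<^sub>M PiM UNIV (\<lambda>_. S)) (\<lambda>\<omega>. (\<lambda>n. \<xi> n \<omega>, \<lambda>n. Y n \<omega>)) =
          PiM UNIV (\<lambda>_. density lborel (\<lambda>x. ennreal (exponential_density 1 x)))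
            \<Otimes>\<^sub>M distr M (PiM UNIV (\<lambda>_. S)) (\<lambda>\<omega> n. Y n \<omega>) \<and>
        (AE \<omega> in M. \<forall>t\<ge>0. \<forall>n.
           jump_time S q Y \<xi> n \<omega> \<le> t \<and> t < jump_time S q Y \<xi> (Suc n) \<omega> \<longrightarrow> V t \<omega> = Y n \<omega>))"


section \<open>The thermostated Kac particle system\<close>

definition gaussian :: "real \<Rightarrow> real measure" where
  "gaussian T = density lborel (\<lambda>w. ennreal (normal_density 0 (sqrt T) w))"

definition angle :: "real measure" where
  "angle = uniform_measure lborel {0..<2 * pi}"

definition ordered_pairs :: "nat \<Rightarrow> (nat \<times> nat) set" where
  "ordered_pairs N = {(i, j). i < N \<and> j < N \<and> i \<noteq> j}"

definition collision_law :: "nat \<Rightarrow> (nat \<Rightarrow> real) \<Rightarrow> (nat \<Rightarrow> real) measure" where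
  "collision_law N v =
     distr (uniform_count_measure (ordered_pairs N) \<Otimes>\<^sub>M angle) (euclid N)
       (\<lambda>((i, j), \<theta>). v(i := v i * cos \<theta> - v j * sin \<theta>, j := v i * sin \<theta> + v j * cos \<theta>))"

definition thermostat_law :: "real \<Rightarrow> nat \<Rightarrow> (nat \<Rightarrow> real) \<Rightarrow> (nat \<Rightarrow> real) measure" where
  "thermostat_law T N v =
     distr (uniform_count_measure {..<N} \<Otimes>\<^sub>M (angle \<Otimes>\<^sub>M gaussian T)) (euclid N)
       (\<lambda>(i, \<theta>, w). v(i := v i * cos \<theta> - w * sin \<theta>))"

definition kac_rate ::
    "real \<Rightarrow> real \<Rightarrow> real \<Rightarrow> nat \<Rightarrow> (nat \<Rightarrow> real) \<Rightarrow> (nat \<Rightarrow> real) set \<Rightarrow> real" where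
  "kac_rate lam \<mu> T N v B =
     lam * real N * measure (collision_law N v) B + \<mu> * real N * measure (thermostat_law T N v) B"

definition thermostated_kac_system ::
    "real \<Rightarrow> real \<Rightarrow> real \<Rightarrow> nat \<Rightarrow> 'a measure \<Rightarrow> (real \<Rightarrow> 'a \<Rightarrow> nat \<Rightarrow> real) \<Rightarrow> bool" where
  "thermostated_kac_system lam \<mu> T N M V \<longleftrightarrow>
     pure_jump_markov_process M (euclid N) (kac_rate lam \<mu> T N) V"

lemma prob_space_angle: "prob_space angle"
  unfolding angle_def by (rule prob_space_uniform_measure) auto

lemma prob_space_gaussian: "T > 0 \<Longrightarrow> prob_space (gaussian T)"
  unfolding gaussian_def by (rule prob_space_normal_density) simp

lemma sets_angle [measurable_cong]: "sets angle = sets borel"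
  by (simp add: angle_def)

lemma sets_gaussian [measurable_cong]: "sets (gaussian T) = sets borel"
  by (simp add: gaussian_def)

lemma gaussian_density_eq:
  assumes "T > 0"
  shows "normal_density 0 (sqrt T) w = (2 * pi * T) powr (- 1 / 2) * exp (- w\<^sup>2 / (2 * T))"
proof -
  have "(2 * pi * T) powr (- 1 / 2) = 1 / sqrt (2 * pi * T)"
    using assms powr_minus_divide[of "2 * pi * T" "1 / 2"] by (simp add: powr_half_sqrt)
  then show ?thesis
    unfolding normal_density_def using assms by simp
qed

lemma finite_ordered_pairs: "finite (ordered_pairs N)"
  by (rule finite_subset[of _ "{..<N} \<times> {..<N}"]) (auto simp: ordered_pairs_def)

lemma ordered_pairs_nonempty:
  assumes "N \<ge> 2"
  shows "ordered_pairs N \<noteq> {}"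
proof -
  have "(0, 1) \<in> ordered_pairs N"
    using assms by (simp add: ordered_pairs_def)
  then show ?thesis by auto
qed

lemma measurable_from_uniform_count_pair:
  assumes "countable A" "\<And>a. a \<in> A \<Longrightarrow> f a \<in> measurable M L"
  shows "(\<lambda>(a, x). f a x) \<in> measurable (uniform_count_measure A \<Otimes>\<^sub>M M) L"
proof -
  have "(\<lambda>(a, x). f a x) \<in> measurable (count_space A \<Otimes>\<^sub>M M) L"
    using assms by (intro measurable_pair_measure_countable1) auto
  moreover have "sets (uniform_count_measure A \<Otimes>\<^sub>M M) = sets (count_space A \<Otimes>\<^sub>M M)"
    by (intro sets_pair_measure_cong) (auto simp: sets_uniform_count_measure)
  ultimately show ?thesis
    by (subst measurable_cong_sets[OF _ refl])
qed

lemma prob_space_collision_law: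
  assumes "N \<ge> 2" "v \<in> space (euclid N)"
  shows "prob_space (collision_law N v)"
proof -
  let ?g = "\<lambda>(i, j) \<theta>. v(i := v i * cos \<theta> - v j * sin \<theta>, j := v i * sin \<theta> + v j * cos \<theta>)"
  have "(\<lambda>(p, \<theta>). ?g p \<theta>) \<in>
      measurable (uniform_count_measure (ordered_pairs N) \<Otimes>\<^sub>M angle) (euclid N)"
  proof (intro measurable_from_uniform_count_pair)
    show "countable (ordered_pairs N)"
      using finite_ordered_pairs by (rule countable_finite)
    show "?g p \<in> measurable angle (euclid N)" if pair: "p \<in> ordered_pairs N" for p
    proof -
      obtain i j where p: "p = (i, j)" and ij: "i < N" "j < N" "i \<noteq> j"
        using pair by (cases p) (auto simp: ordered_pairs_def)
      have v: "v k = undefined" if "k \<notin> {..<N}" for k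
        using assms(2) that by (auto simp: space_PiM PiE_def extensional_def)
      show ?thesis
        unfolding p prod.case
      proof (rule measurable_PiM_single')
        show "(\<lambda>\<theta>. (v(i := v i * cos \<theta> - v j * sin \<theta>, j := v i * sin \<theta> + v j * cos \<theta>)) k)
            \<in> measurable angle borel" if "k \<in> {..<N}" for k
          unfolding fun_upd_apply by measurable
      qed (use ij v in \<open>auto simp: PiE_def extensional_def\<close>)
    qed
  qed
  moreover have "prob_space (uniform_count_measure (ordered_pairs N) \<Otimes>\<^sub>M angle)"
    using prob_space_angle finite_ordered_pairs ordered_pairs_nonempty[OF assms(1)]
    by (intro prob_space_pair prob_space_uniform_count_measure)
  ultimately show ?thesis
    unfolding collision_law_def
    by (intro prob_space.prob_space_distr)
qed

lemma prob_space_thermostat_law: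
  assumes "N \<ge> 1" "T > 0" "v \<in> space (euclid N)"
  shows "prob_space (thermostat_law T N v)"
proof -
  let ?g = "\<lambda>i (\<theta>, w). v(i := v i * cos \<theta> - w * sin \<theta>)"
  have "(\<lambda>(i, x). ?g i x) \<in>
      measurable (uniform_count_measure {..<N} \<Otimes>\<^sub>M (angle \<Otimes>\<^sub>M gaussian T)) (euclid N)"
  proof (intro measurable_from_uniform_count_pair)
    show "?g i \<in> measurable (angle \<Otimes>\<^sub>M gaussian T) (euclid N)" if i: "i \<in> {..<N}" for i
    proof -
      have v: "v k = undefined" if "k \<notin> {..<N}" for k
        using assms(3) that by (auto simp: space_PiM PiE_def extensional_def)
      show ?thesis
        unfolding case_prod_unfold
      proof (rule measurable_PiM_single')
        show "(\<lambda>x. (v(i := v i * cos (fst x) - snd x * sin (fst x))) k)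
            \<in> measurable (angle \<Otimes>\<^sub>M gaussian T) borel" if "k \<in> {..<N}" for k
          unfolding fun_upd_apply by measurable
      qed (use i v in \<open>auto simp: PiE_def extensional_def\<close>)
    qed
  qed simp
  moreover have "prob_space (uniform_count_measure {..<N} \<Otimes>\<^sub>M (angle \<Otimes>\<^sub>M gaussian T))"
    using prob_space_angle prob_space_gaussian[OF assms(2)] assms(1)
    by (intro prob_space_pair prob_space_uniform_count_measure) (auto simp: lessThan_empty_iff)
  ultimately show ?thesis
    unfolding thermostat_law_def
    by (intro prob_space.prob_space_distr)
qed

lemma kac_rate_total:
  assumes "N \<ge> 2" "T > 0" "v \<in> space (euclid N)"
  shows "kac_rate lam \<mu> T N v (space (euclid N)) = (lam + \<mu>) * real N"
proof -
  have "measure (collision_law N v) (space (euclid N)) = 1"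
    using prob_space.prob_space[OF prob_space_collision_law[OF assms(1,3)]]
    by (simp add: collision_law_def)
  moreover have "measure (thermostat_law T N v) (space (euclid N)) = 1"
    using prob_space.prob_space[OF prob_space_thermostat_law[OF _ assms(2,3)]] assms(1)
    by (simp add: thermostat_law_def)
  ultimately show ?thesis
    by (simp add: kac_rate_def algebra_simps)
qed

end

theory Submission
  imports Defs
begin

text \<open>Since every state is left at the same rate \<open>c = (\<lambda> + \<mu>) N\<close>, the jump number is a Poisson
  process independent of the jump chain, and the law at time \<open>t\<close> is the \<open>Poisson (c t)\<close> mixture of
  the laws of the chain. Couple two chains synchronously: same kind of jump, same particles, same
  angle, same \<open>w\<close>. A collision is a rotation and preserves \<open>(1/N) \<Sum> (x\<^sub>k - y\<^sub>k)\<^sup>2\<close>; a thermostat jump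
  multiplies one squared difference by \<open>cos\<^sup>2 \<theta>\<close>, of mean \<open>1/2\<close>, and hence the cost by \<open>1 - 1/(2N)\<close> on
  average. So each jump contracts the cost by \<open>a = 1 - \<mu> / (2 N (\<lambda> + \<mu>))\<close>, and averaging \<open>a\<^sup>n\<close> over the
  number of jumps gives \<open>exp (- c t (1 - a)) = exp (- \<mu> t / 2)\<close>. The Gaussian product law is invariant
  under one jump because a pair of independent centered Gaussians of equal variance is invariant
  under rotations.\<close>


section \<open>Poisson jump counts\<close>

abbreviation (input) iid_exp :: "(nat \<Rightarrow> real) measure" where
  "iid_exp \<equiv> PiM UNIV (\<lambda>_. density lborel (\<lambda>x. ennreal (exponential_density 1 x)))"

text \<open>With \<open>x\<close> as the waiting times of a unit-rate Poisson process, this is the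
  event of exactly \<open>n\<close> arrivals by time \<open>s\<close>. Nonnegativity is built in so
  that the events for different \<open>n\<close> are disjoint everywhere and not merely almost
  surely.\<close>

definition arrival_event :: "real \<Rightarrow> nat \<Rightarrow> (nat \<Rightarrow> real) set" where
  "arrival_event s n = {x. (\<forall>k. 0 \<le> x k) \<and> (\<Sum>k<n. x k) \<le> s \<and> s < (\<Sum>k<Suc n. x k)}"

definition poisson_weight :: "real \<Rightarrow> nat \<Rightarrow> real" where
  "poisson_weight s n = s ^ n / fact n * exp (- s)"

lemma poisson_weight_nonneg: "0 \<le> s \<Longrightarrow> 0 \<le> poisson_weight s n"
  by (simp add: poisson_weight_def)

text \<open>The generating function of the Poisson law with mean \<open>s\<close>, read off from the
  exponential series. At \<open>z = 1\<close> it gives total mass one; at the contraction factor of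
  one jump it will give the decay in time.\<close>

lemma poisson_weight_generating: "(\<lambda>n. poisson_weight s n * z ^ n) sums exp (- s * (1 - z))"
proof -
  have "(\<lambda>n. exp (- s) * ((s * z) ^ n /\<^sub>R fact n)) sums (exp (- s) * exp (s * z))"
    by (intro sums_mult exp_converges)
  then show ?thesis
    by (simp add: poisson_weight_def power_mult_distrib divide_inverse mult_ac exp_add[symmetric]
        algebra_simps)
qed

lemma poisson_weight_sums: "poisson_weight s sums 1"
  using poisson_weight_generating[of s 1] by simp

text \<open>Partial sums of nonnegative terms increase, so the index at which they first exceed
  \<open>s\<close> is unique.\<close>

lemma disjoint_arrival_event: "disjoint_family (arrival_event s)"
proof -
  have "arrival_event s m \<inter> arrival_event s n = {}" if "m < n" for m n
  proof -
    have False if "x \<in> arrival_event s m" "x \<in> arrival_event s n" for x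
    proof -
      have "s < (\<Sum>k<Suc m. x k)" "\<forall>k. 0 \<le> x k" "(\<Sum>k<n. x k) \<le> s"
        using that by (auto simp: arrival_event_def)
      moreover have "(\<Sum>k<Suc m. x k) \<le> (\<Sum>k<n. x k)"
        using \<open>m < n\<close> calculation(2) by (intro sum_mono2) auto
      ultimately show False by linarith
    qed
    then show ?thesis by blast
  qed
  then show ?thesis
    unfolding disjoint_family_on_def by (metis Int_commute nat_neq_iff)
qed

lemma sets_iid_exp: "sets iid_exp = sets (PiM UNIV (\<lambda>_. borel))"
  by (intro sets_PiM_cong) auto

lemma space_iid_exp: "space iid_exp = UNIV"
  by (simp add: space_PiM)

lemma prob_space_iid_exp: "prob_space iid_exp"
  by (intro prob_space_PiM prob_space_exponential_density) simp

lemma arrival_event_sets: "arrival_event s n \<in> sets (PiM UNIV (\<lambda>_. borel))"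
proof -
  have "{x \<in> space (PiM UNIV (\<lambda>_. borel)). (\<forall>k::nat. (0::real) \<le> x k) \<and> (\<Sum>k<n. x k) \<le> s \<and> s < (\<Sum>k<Suc n. x k)}
     \<in> sets (PiM UNIV (\<lambda>_. borel))"
    by measurable
  then show ?thesis by (simp add: arrival_event_def space_PiM)
qed

lemma iid_exp_coordinate:
  "distr iid_exp borel (\<lambda>x. x k) = density lborel (\<lambda>x. ennreal (exponential_density 1 x))"
proof -
  have "distr iid_exp (density lborel (\<lambda>x. ennreal (exponential_density 1 x))) (\<lambda>x. x k)
      = density lborel (\<lambda>x. ennreal (exponential_density 1 x))"
    by (intro distr_PiM_component prob_space_exponential_density) auto
  then show ?thesis by (metis distr_cong sets_density sets_lborel)
qed

text \<open>A sum of \<open>n\<close> independent standard exponentials is Erlang distributed, and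
  the Erlang distribution function is one minus a truncated Poisson series.\<close>

lemma iid_exp_partial_sum:
  assumes "0 \<le> s"
  shows "measure iid_exp {x. (\<Sum>k<n. x k) \<le> s} = 1 - (\<Sum>k<n. poisson_weight s k)"
proof (cases n)
  case 0
  then show ?thesis using assms prob_space.prob_space[OF prob_space_iid_exp] by (simp add: space_iid_exp)
next
  case (Suc m)
  interpret prob_space iid_exp by (rule prob_space_iid_exp)
  have rv: "random_variable borel (\<lambda>x. x k)" for k
    unfolding measurable_cong_sets[OF sets_iid_exp refl] by measurable
  have ind: "indep_vars (\<lambda>_. borel) (\<lambda>k x. x k) UNIV"
    using rv by (subst indep_vars_iff_distr_eq_PiM)
      (auto simp: iid_exp_coordinate restrict_UNIV intro!: distr_id2 sets_iid_exp[symmetric])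
  \<comment> \<open>The Erlang index counts from 0: a sum of \<open>n\<close> exponentials has index
    \<open>n - 1\<close>, hence the separate case \<open>n = 0\<close>.\<close>
  have "distributed iid_exp lborel (\<lambda>x. \<Sum>k<n. x k) (erlang_density (card {..<n} - 1) 1)"
  proof (rule exponential_distributed_sum)
    show "distributed iid_exp lborel (\<lambda>x. x k) (exponential_density 1)" if "k \<in> {..<n}" for k
      using rv[of k] iid_exp_coordinate[of k] unfolding distributed_def
      by (auto cong: distr_cong)
    show "indep_vars (\<lambda>i. borel) (\<lambda>k x. x k) {..<n}"
      using ind by (rule indep_vars_subset) simp
  qed (use Suc in auto)
  then have "\<P>(x in iid_exp. (\<Sum>k<n. x k) \<le> s) = erlang_CDF m 1 s"
    by (intro erlang_distributed_le) (use Suc assms in auto)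
  then show ?thesis
    using assms Suc by (simp add: space_iid_exp erlang_CDF_def poisson_weight_def lessThan_Suc_atMost)
qed

lemma AE_iid_exp_nonneg: "AE x in iid_exp. \<forall>k. 0 \<le> x k"
proof -
  have "AE x in iid_exp. 0 \<le> x k" for k
    using prob_space_exponential_density[of 1]
    by (intro AE_PiM_component) (simp_all add: AE_density exponential_density_def)
  then show ?thesis by (simp add: AE_all_countable)
qed

text \<open>Up to a null set the event is \<open>?L n\<close> minus its subset
  \<open>?L (Suc n)\<close>, so its probability is the difference of two consecutive truncated
  Poisson series, which is a single term.\<close>

lemma emeasure_arrival_event:
  assumes "0 \<le> s"
  shows "emeasure iid_exp (arrival_event s n) = poisson_weight s n"
proof -
  interpret prob_space iid_exp by (rule prob_space_iid_exp)
  let ?L = "\<lambda>n. {x. (\<Sum>k<n. x k) \<le> s}"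
  have L[measurable]: "?L n \<in> sets iid_exp" for n
  proof -
    have "{x \<in> space (PiM UNIV (\<lambda>_. borel)). (\<Sum>k<n. x k) \<le> s} \<in> sets (PiM UNIV (\<lambda>_. borel))"
      by measurable
    then show ?thesis by (simp add: sets_iid_exp space_PiM)
  qed
  have "prob (arrival_event s n) = prob (?L n - ?L (Suc n))"
  proof (rule finite_measure_eq_AE)
    show "AE x in iid_exp. x \<in> arrival_event s n \<longleftrightarrow> x \<in> ?L n - ?L (Suc n)"
      using AE_iid_exp_nonneg by eventually_elim (auto simp: arrival_event_def)
    show "arrival_event s n \<in> events"
      by (simp add: arrival_event_sets sets_iid_exp)
    show "?L n - ?L (Suc n) \<in> events"
      by (intro sets.Diff L)
  qed
  also have "\<dots> = prob (?L n) - prob (?L n \<inter> ?L (Suc n))"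
    by (intro finite_measure_Diff' L)
  also have "prob (?L n \<inter> ?L (Suc n)) = prob (?L (Suc n))"
  proof (rule finite_measure_eq_AE)
    show "AE x in iid_exp. x \<in> ?L n \<inter> ?L (Suc n) \<longleftrightarrow> x \<in> ?L (Suc n)"
      using AE_iid_exp_nonneg by eventually_elim (auto elim: order_trans[rotated])
  qed (intro sets.Int L)+
  finally have "prob (arrival_event s n) = poisson_weight s n"
    unfolding iid_exp_partial_sum[OF assms] by simp
  then show ?thesis
    by (simp add: emeasure_eq_measure)
qed

text \<open>When all states have the same rate \<open>c\<close>, the jump times are functions of the
  waiting times alone. The number of jumps by time \<open>t\<close> is then independent of the chain
  and Poisson with mean \<open>c * t\<close>, so only the laws of \<open>Y n\<close> at fixed
  \<open>n\<close> enter the law of \<open>V t\<close>.\<close>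

lemma pure_jump_marginal:
  assumes "pure_jump_markov_process M S q V" and c: "0 < c" "\<And>x. x \<in> space S \<Longrightarrow> q x (space S) = c"
  obtains Y where "markov_chain M S (\<lambda>x B. q x B / q x (space S)) Y"
    and "\<And>t B. 0 \<le> t \<Longrightarrow> B \<in> sets S \<Longrightarrow> emeasure (distr M S (V t)) B =
          (\<Sum>n. ennreal (poisson_weight (c * t) n) * emeasure (distr M S (Y n)) B)"
proof -
  interpret prob_space M using assms(1) by (simp add: pure_jump_markov_process_def)
  obtain Y \<xi> where Y: "markov_chain M S (\<lambda>x B. q x B / q x (space S)) Y"
    and \<xi>[measurable]: "\<And>n. \<xi> n \<in> borel_measurable M"
    and indep: "distr M (PiM UNIV (\<lambda>_. borel) \<Otimes>\<^sub>M PiM UNIV (\<lambda>_. S)) (\<lambda>\<omega>. (\<lambda>n. \<xi> n \<omega>, \<lambda>n. Y n \<omega>)) =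
          iid_exp \<Otimes>\<^sub>M distr M (PiM UNIV (\<lambda>_. S)) (\<lambda>\<omega> n. Y n \<omega>)"
    and V: "AE \<omega> in M. \<forall>t\<ge>0. \<forall>n.
           jump_time S q Y \<xi> n \<omega> \<le> t \<and> t < jump_time S q Y \<xi> (Suc n) \<omega> \<longrightarrow> V t \<omega> = Y n \<omega>"
    and Vm: "\<And>t. 0 \<le> t \<Longrightarrow> V t \<in> measurable M S"
    using assms(1) unfolding pure_jump_markov_process_def by blast
  have Ym[measurable]: "Y n \<in> measurable M S" for n
    using Y by (simp add: markov_chain_def)
  let ?\<xi> = "\<lambda>\<omega> n. \<xi> n \<omega>" and ?Y = "\<lambda>\<omega> n. Y n \<omega>"
  let ?SY = "PiM UNIV (\<lambda>_::nat. S)" and ?S\<xi> = "PiM UNIV (\<lambda>_::nat. borel :: real measure)"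
  have \<xi>m[measurable]: "?\<xi> \<in> measurable M ?S\<xi>" and Yall[measurable]: "?Y \<in> measurable M ?SY"
    by (auto intro!: measurable_PiM_single' simp: PiE_def intro: measurable_space[OF Ym])
  interpret Y: prob_space "distr M ?SY ?Y" by (rule prob_space_distr) fact
  \<comment> \<open>The independence of waiting times and chain, read off from the product form of
    the joint law on rectangles.\<close>
  have joint: "emeasure M {\<omega> \<in> space M. ?\<xi> \<omega> \<in> A \<and> ?Y \<omega> \<in> C} = emeasure iid_exp A * emeasure M {\<omega> \<in> space M. ?Y \<omega> \<in> C}"
    if A: "A \<in> sets ?S\<xi>" and C: "C \<in> sets ?SY" for A C
  proof -
    have "emeasure M {\<omega> \<in> space M. ?\<xi> \<omega> \<in> A \<and> ?Y \<omega> \<in> C} =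
        emeasure (distr M (?S\<xi> \<Otimes>\<^sub>M ?SY) (\<lambda>\<omega>. (?\<xi> \<omega>, ?Y \<omega>))) (A \<times> C)"
      using A C by (subst emeasure_distr) (auto intro!: arg_cong[of _ _ "emeasure M"])
    also have "\<dots> = emeasure iid_exp A * emeasure (distr M ?SY ?Y) C"
      unfolding indep using A C sets_iid_exp by (intro Y.emeasure_pair_measure_Times) auto
    also have "emeasure (distr M ?SY ?Y) C = emeasure M {\<omega> \<in> space M. ?Y \<omega> \<in> C}"
      using C by (subst emeasure_distr) (auto intro!: arg_cong[of _ _ "emeasure M"])
    finally show ?thesis .
  qed
  show ?thesis
  proof (rule that[OF Y])
    fix t :: real and B assume t: "0 \<le> t" and B[measurable]: "B \<in> sets S"
    have ct: "0 \<le> c * t" using t c by simp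
    \<comment> \<open>Exactly \<open>n\<close> jumps by time \<open>t\<close>: the jump times are
      partial sums of \<open>\<xi>\<close> divided by \<open>c\<close>, so the level for the partial
      sums is \<open>c * t\<close>.\<close>
    define E where "E n = {\<omega> \<in> space M. ?\<xi> \<omega> \<in> arrival_event (c * t) n}" for n
    have E[measurable]: "E n \<in> sets M" for n
      unfolding E_def using \<xi>m arrival_event_sets by measurable
    have disj: "disjoint_family E"
      using disjoint_arrival_event[of "c * t"] unfolding E_def disjoint_family_on_def by auto
    have EY: "emeasure M {\<omega> \<in> space M. \<omega> \<in> E n \<and> Y n \<omega> \<in> C} =
        ennreal (poisson_weight (c * t) n) * emeasure (distr M S (Y n)) C" if C[measurable]: "C \<in> sets S" for n C
    proof -
      have CY: "{y \<in> space ?SY. y n \<in> C} \<in> sets ?SY" by measurable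
      have "{\<omega> \<in> space M. \<omega> \<in> E n \<and> Y n \<omega> \<in> C} =
          {\<omega> \<in> space M. ?\<xi> \<omega> \<in> arrival_event (c * t) n \<and> ?Y \<omega> \<in> {y \<in> space ?SY. y n \<in> C}}"
        using measurable_space[OF Yall] by (auto simp: E_def)
      also have "emeasure M \<dots> = emeasure iid_exp (arrival_event (c * t) n) *
          emeasure M {\<omega> \<in> space M. ?Y \<omega> \<in> {y \<in> space ?SY. y n \<in> C}}"
        by (rule joint[OF arrival_event_sets CY])
      also have "{\<omega> \<in> space M. ?Y \<omega> \<in> {y \<in> space ?SY. y n \<in> C}} = Y n -` C \<inter> space M"
        using measurable_space[OF Yall] by auto
      finally show ?thesis
        by (simp add: emeasure_arrival_event[OF ct] emeasure_distr)
    qed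
    \<comment> \<open>The Poisson weights sum to one, so almost every outcome lies in some
      \<open>E n\<close>; in particular the jump times almost surely do not accumulate before
      \<open>t\<close>.\<close>
    have "emeasure M (\<Union>n. E n) = (\<Sum>n. emeasure M (E n))"
      using disj by (intro suminf_emeasure[symmetric]) auto
    also have "\<dots> = (\<Sum>n. ennreal (poisson_weight (c * t) n))"
    proof (intro suminf_cong)
      fix n
      have "E n = {\<omega> \<in> space M. \<omega> \<in> E n \<and> Y n \<omega> \<in> space S}"
        using measurable_space[OF Ym] by (auto simp: E_def)
      then show "emeasure M (E n) = ennreal (poisson_weight (c * t) n)"
        using EY[of "space S" n] prob_space.emeasure_space_1[OF prob_space_distr[OF Ym[of n]]] by simp
    qed
    also have "\<dots> = 1"
      using poisson_weight_sums[of "c * t"] poisson_weight_nonneg[OF ct]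
      by (simp add: suminf_ennreal2 sums_iff)
    finally have cover: "AE \<omega> in M. \<omega> \<in> (\<Union>n. E n)"
      by (subst AE_in_set_eq_1) (auto simp: emeasure_eq_measure)
    have VE: "AE \<omega> in M. \<forall>n. \<omega> \<in> E n \<longrightarrow> V t \<omega> = Y n \<omega>"
      using V AE_space
    proof eventually_elim
      fix \<omega> assume V\<omega>: "\<forall>t\<ge>0. \<forall>n.
           jump_time S q Y \<xi> n \<omega> \<le> t \<and> t < jump_time S q Y \<xi> (Suc n) \<omega> \<longrightarrow> V t \<omega> = Y n \<omega>"
        and \<omega>: "\<omega> \<in> space M"
      have J: "jump_time S q Y \<xi> n \<omega> = (\<Sum>k<n. \<xi> k \<omega>) / c" for n
        using c(2)[OF measurable_space[OF Ym \<omega>]] by (simp add: jump_time_def sum_divide_distrib)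
      show "\<forall>n. \<omega> \<in> E n \<longrightarrow> V t \<omega> = Y n \<omega>"
        using V\<omega> t c(1) unfolding J by (auto simp: E_def arrival_event_def field_simps)
    qed
    have "emeasure (distr M S (V t)) B = emeasure M (\<Union>n. {\<omega> \<in> space M. \<omega> \<in> E n \<and> Y n \<omega> \<in> B})"
      unfolding emeasure_distr[OF Vm[OF t] B]
    proof (rule emeasure_eq_AE)
      show "AE \<omega> in M. \<omega> \<in> V t -` B \<inter> space M \<longleftrightarrow> \<omega> \<in> (\<Union>n. {\<omega> \<in> space M. \<omega> \<in> E n \<and> Y n \<omega> \<in> B})"
        using cover VE AE_space by eventually_elim auto
    qed (use Vm[OF t] in measurable)
    also have "\<dots> = (\<Sum>n. emeasure M {\<omega> \<in> space M. \<omega> \<in> E n \<and> Y n \<omega> \<in> B})"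
      using disj by (intro suminf_emeasure[symmetric]) (auto simp: disjoint_family_on_def)
    finally show "emeasure (distr M S (V t)) B =
          (\<Sum>n. ennreal (poisson_weight (c * t) n) * emeasure (distr M S (Y n)) B)"
      by (simp add: EY)
  qed
qed


section \<open>Synchronous coupling\<close>

text \<open>The state \<open>x\<close> has law \<open>f\<close> and is independent of the noise
  \<open>u\<close>. Writing a transition as a deterministic map driven by noise, rather than as a
  kernel, is what allows two copies to share their noise.\<close>

definition random_step :: "'u measure \<Rightarrow> 'x measure \<Rightarrow> ('u \<Rightarrow> 'x \<Rightarrow> 'x) \<Rightarrow> 'x measure \<Rightarrow> 'x measure" where
  "random_step U S G f = distr (U \<Otimes>\<^sub>M f) S (\<lambda>(u, x). G u x)"

lemma random_step_prob_algebra: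
  assumes "prob_space U" "prob_space f" "sets f = sets S"
    and G: "(\<lambda>(u, x). G u x) \<in> measurable (U \<Otimes>\<^sub>M S) S"
  shows "random_step U S G f \<in> space (prob_algebra S)"
proof -
  have "(\<lambda>(u, x). G u x) \<in> measurable (U \<Otimes>\<^sub>M f) S"
    using G measurable_cong_sets[OF sets_pair_measure_cong[OF refl assms(3)] refl] by blast
  then show ?thesis
    unfolding random_step_def space_prob_algebra
    using assms(1,2) by (auto intro!: prob_space.prob_space_distr prob_space_pair)
qed

text \<open>Tonelli with the noise integrated first recovers the kernel form of the step, in which
  the transition probabilities of the chain are given.\<close>

lemma emeasure_random_step:
  assumes "prob_space U" "prob_space f" and f[measurable_cong]: "sets f = sets S"
    and G[measurable]: "(\<lambda>(u, x). G u x) \<in> measurable (U \<Otimes>\<^sub>M S) S" and B[measurable]: "B \<in> sets S"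
  shows "emeasure (random_step U S G f) B = (\<integral>\<^sup>+ x. emeasure (distr U S (\<lambda>u. G u x)) B \<partial>f)"
proof -
  interpret U: prob_space U by fact
  interpret f: prob_space f by fact
  interpret pair_sigma_finite U f ..
  have "emeasure (random_step U S G f) B = (\<integral>\<^sup>+ y. indicator B y \<partial>random_step U S G f)"
    by (simp add: random_step_def)
  also have "\<dots> = (\<integral>\<^sup>+ z. indicator B (case z of (u, x) \<Rightarrow> G u x) \<partial>(U \<Otimes>\<^sub>M f))"
    unfolding random_step_def by (intro nn_integral_distr) simp_all
  also have "\<dots> = (\<integral>\<^sup>+ x. \<integral>\<^sup>+ u. indicator B (G u x) \<partial>U \<partial>f)"
    by (subst nn_integral_snd[symmetric]) (auto simp: case_prod_beta')
  also have "\<dots> = (\<integral>\<^sup>+ x. emeasure (distr U S (\<lambda>u. G u x)) B \<partial>f)"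
  proof (intro nn_integral_cong)
    fix x assume "x \<in> space f"
    then have [measurable]: "(\<lambda>u. G u x) \<in> measurable U S"
      using measurable_Pair2[OF G] sets_eq_imp_space_eq[OF f] by simp
    have "(\<integral>\<^sup>+ u. indicator B (G u x) \<partial>U) = (\<integral>\<^sup>+ y. indicator B y \<partial>distr U S (\<lambda>u. G u x))"
      by (rule nn_integral_distr[symmetric]) simp_all
    then show "(\<integral>\<^sup>+ u. indicator B (G u x) \<partial>U) = emeasure (distr U S (\<lambda>u. G u x)) B"
      by simp
  qed
  finally show ?thesis .
qed

lemma couplingsD:
  assumes "P \<in> couplings k f g"
  shows "prob_space P" "sets P = sets (euclid k \<Otimes>\<^sub>M euclid k)"
    "distr P (euclid k) fst = f" "distr P (euclid k) snd = g"
    "f \<in> space (prob_algebra (euclid k))" "g \<in> space (prob_algebra (euclid k))"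
proof -
  show *: "prob_space P" "sets P = sets (euclid k \<Otimes>\<^sub>M euclid k)"
    "distr P (euclid k) fst = f" "distr P (euclid k) snd = g"
    using assms by (auto simp: couplings_def)
  have m: "fst \<in> measurable P (euclid k)" "snd \<in> measurable P (euclid k)"
    unfolding measurable_cong_sets[OF *(2) refl] by (rule measurable_fst measurable_snd)+
  have "prob_space (distr P (euclid k) fst)" "prob_space (distr P (euclid k) snd)"
    by (rule prob_space.prob_space_distr[OF *(1)], rule m)+
  then show "f \<in> space (prob_algebra (euclid k))" "g \<in> space (prob_algebra (euclid k))"
    unfolding *(3,4)[symmetric] space_prob_algebra by simp_all
qed

definition synchronous_step ::
    "'u measure \<Rightarrow> 'x measure \<Rightarrow> ('u \<Rightarrow> 'x \<Rightarrow> 'x) \<Rightarrow> ('x \<times> 'x) measure \<Rightarrow> ('x \<times> 'x) measure" where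
  "synchronous_step U S G P = random_step U (S \<Otimes>\<^sub>M S) (\<lambda>u (x, y). (G u x, G u y)) P"

text \<open>Each copy sees the same noise law, independent of its own state; sharing the noise
  correlates the copies but leaves both marginal evolutions intact.\<close>

lemma distr_synchronous_step:
  assumes "prob_space U" "prob_space P" and P[measurable_cong]: "sets P = sets (S \<Otimes>\<^sub>M S)"
    and G[measurable]: "(\<lambda>(u, x). G u x) \<in> measurable (U \<Otimes>\<^sub>M S) S"
  shows "distr (synchronous_step U S G P) S fst = random_step U S G (distr P S fst)"
    and "distr (synchronous_step U S G P) S snd = random_step U S G (distr P S snd)"
proof -
  interpret P: prob_space P by fact
  have *: "random_step U S G (distr P S \<pi>) = distr (U \<Otimes>\<^sub>M P) S (\<lambda>(u, z). G u (\<pi> z))"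
    if \<pi>[measurable]: "\<pi> \<in> measurable P S" for \<pi>
  proof -
    interpret D: prob_space "distr P S \<pi>" by (rule P.prob_space_distr) fact
    \<comment> \<open>Reading \<open>U\<close> as its own image under the identity makes the product
      an image of \<open>U \<Otimes>\<^sub>M P\<close> under the map that projects the state
      only.\<close>
    have "U \<Otimes>\<^sub>M distr P S \<pi> = distr U U (\<lambda>x. x) \<Otimes>\<^sub>M distr P S \<pi>"
      by simp
    also have "\<dots> = distr (U \<Otimes>\<^sub>M P) (U \<Otimes>\<^sub>M S) (\<lambda>(u, z). (u, \<pi> z))"
      by (rule pair_measure_distr) (auto intro: D.sigma_finite_measure_axioms)
    finally show ?thesis
      unfolding random_step_def by (simp add: distr_distr comp_def case_prod_beta')
  qed
  have [measurable]: "(\<lambda>(u, x, y). (G u x, G u y)) \<in> measurable (U \<Otimes>\<^sub>M P) (S \<Otimes>\<^sub>M S)"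
    by measurable
  show "distr (synchronous_step U S G P) S fst = random_step U S G (distr P S fst)"
    "distr (synchronous_step U S G P) S snd = random_step U S G (distr P S snd)"
    unfolding synchronous_step_def random_step_def[of U "S \<Otimes>\<^sub>M S"]
    by (simp_all add: * distr_distr comp_def case_prod_beta')
qed

lemma synchronous_step_couplings:
  assumes "prob_space U" "P \<in> couplings k f g"
    and G[measurable]: "(\<lambda>(u, x). G u x) \<in> measurable (U \<Otimes>\<^sub>M euclid k) (euclid k)"
  shows "synchronous_step U (euclid k) G P \<in>
    couplings k (random_step U (euclid k) G f) (random_step U (euclid k) G g)"
proof -
  note P = couplingsD[OF assms(2)]
  have "(\<lambda>(u, x, y). (G u x, G u y)) \<in>
      measurable (U \<Otimes>\<^sub>M euclid k \<Otimes>\<^sub>M euclid k) (euclid k \<Otimes>\<^sub>M euclid k)"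
    by measurable
  from random_step_prob_algebra[OF assms(1) P(1,2) this]
  show ?thesis
    using distr_synchronous_step[OF assms(1) P(1,2) G]
    by (simp add: couplings_def P space_prob_algebra synchronous_step_def)
qed

text \<open>Integrating the noise first reduces any cost estimate to one fixed pair
  \<open>(x, y)\<close>, whatever the coupling \<open>P\<close> is.\<close>

lemma nn_integral_synchronous_step:
  assumes "prob_space U" "prob_space P" and P[measurable_cong]: "sets P = sets (S \<Otimes>\<^sub>M S)"
    and G[measurable]: "(\<lambda>(u, x). G u x) \<in> measurable (U \<Otimes>\<^sub>M S) S"
    and d[measurable]: "(\<lambda>(x, y). d x y) \<in> borel_measurable (S \<Otimes>\<^sub>M S)"
  shows "(\<integral>\<^sup>+ (x, y). d x y \<partial>synchronous_step U S G P) =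
    (\<integral>\<^sup>+ (x, y). (\<integral>\<^sup>+ u. d (G u x) (G u y) \<partial>U) \<partial>P)"
proof -
  interpret U: prob_space U by fact
  interpret P: prob_space P by fact
  interpret pair_sigma_finite U P ..
  have "(\<integral>\<^sup>+ (x, y). d x y \<partial>synchronous_step U S G P) =
      (\<integral>\<^sup>+ (u, x, y). d (G u x) (G u y) \<partial>(U \<Otimes>\<^sub>M P))"
    unfolding synchronous_step_def random_step_def
    by (subst nn_integral_distr) (auto simp: case_prod_beta')
  also have "\<dots> = (\<integral>\<^sup>+ (x, y). (\<integral>\<^sup>+ u. d (G u x) (G u y) \<partial>U) \<partial>P)"
    by (subst nn_integral_snd[symmetric]) (auto simp: case_prod_beta')
  finally show ?thesis .
qed

section \<open>Mixtures over a discrete random choice\<close>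

lemma measurable_count_prob_algebra:
  assumes "\<And>i. F i \<in> space (prob_algebra S)"
  shows "F \<in> measurable (count_space UNIV) (prob_algebra S)"
    and "F \<in> measurable (measure_pmf p) (subprob_algebra S)"
proof -
  show *: "F \<in> measurable (count_space UNIV) (prob_algebra S)"
    using assms by simp
  show "F \<in> measurable (measure_pmf p) (subprob_algebra S)"
    using measurable_prob_algebraD[OF *] by (simp add: measurable_pmf_measure1)
qed

text \<open>Taking marginals commutes with mixing, so drawing one index for both copies couples the
  two mixtures. This serves twice: for the kind of a jump (Bernoulli) and for the number of jumps
  (Poisson).\<close>

lemma bind_pmf_couplings:
  assumes "\<And>i. P i \<in> couplings k (f i) (g i)"
  shows "measure_pmf p \<bind> P \<in> couplings k (measure_pmf p \<bind> f) (measure_pmf p \<bind> g)"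
proof -
  note P = couplingsD[OF assms]
  have "P i \<in> space (prob_algebra (euclid k \<Otimes>\<^sub>M euclid k))" for i
    by (simp add: space_prob_algebra P)
  note PM = measurable_count_prob_algebra[of P, OF this]
  have p: "measure_pmf p \<in> space (prob_algebra (count_space UNIV))"
    by (simp add: space_prob_algebra prob_space_measure_pmf)
  have "distr (measure_pmf p \<bind> P) (euclid k) fst = measure_pmf p \<bind> f"
    "distr (measure_pmf p \<bind> P) (euclid k) snd = measure_pmf p \<bind> g"
    using PM(2) by (simp_all add: distr_bind P)
  then show ?thesis
    using prob_space_bind'[OF p PM(1)] sets_bind'[OF p PM(1)] by (simp add: couplings_def)
qed

section \<open>The transport cost of a coupling\<close>

definition transport_cost :: "nat \<Rightarrow> ((nat \<Rightarrow> real) \<times> (nat \<Rightarrow> real)) measure \<Rightarrow> ennreal" where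
  "transport_cost k P = (\<integral>\<^sup>+ (x, y). ennreal (1 / real k * (\<Sum>i<k. (x i - y i)\<^sup>2)) \<partial>P)"

lemma W2_square: "(W2 k f g)\<^sup>2 = (INF P\<in>couplings k f g. transport_cost k P)"
  by (simp add: W2_def ennreal_sqrt_power2 transport_cost_def)

lemma measurable_transport_cost [measurable]:
  "(\<lambda>(x, y). ennreal (1 / real k * (\<Sum>i<k. (x i - y i)\<^sup>2))) \<in> borel_measurable (euclid k \<Otimes>\<^sub>M euclid k)"
  by measurable

lemma transport_cost_bind_pmf:
  assumes "\<And>i. P i \<in> couplings k (f i) (g i)"
  shows "transport_cost k (measure_pmf p \<bind> P) = (\<integral>\<^sup>+ i. transport_cost k (P i) \<partial>measure_pmf p)"
  unfolding transport_cost_def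
  by (rule nn_integral_bind[where B = "euclid k \<Otimes>\<^sub>M euclid k"])
    (rule measurable_transport_cost, rule measurable_count_prob_algebra,
      simp add: space_prob_algebra couplingsD[OF assms])


section \<open>The jump chain of the Kac system\<close>

definition collision_noise :: "nat \<Rightarrow> ((nat \<times> nat) \<times> real) measure" where
  "collision_noise N = uniform_count_measure (ordered_pairs N) \<Otimes>\<^sub>M angle"

definition collide :: "(nat \<times> nat) \<times> real \<Rightarrow> (nat \<Rightarrow> real) \<Rightarrow> nat \<Rightarrow> real" where
  "collide = (\<lambda>((i, j), \<theta>) v.
     v(i := v i * cos \<theta> - v j * sin \<theta>, j := v i * sin \<theta> + v j * cos \<theta>))"

definition thermostat_noise :: "real \<Rightarrow> nat \<Rightarrow> (nat \<times> real \<times> real) measure" where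
  "thermostat_noise T N = uniform_count_measure {..<N} \<Otimes>\<^sub>M (angle \<Otimes>\<^sub>M gaussian T)"

definition thermalize :: "nat \<times> real \<times> real \<Rightarrow> (nat \<Rightarrow> real) \<Rightarrow> nat \<Rightarrow> real" where
  "thermalize = (\<lambda>(i, \<theta>, w) v. v(i := v i * cos \<theta> - w * sin \<theta>))"

lemma collision_law_eq: "collision_law N v = distr (collision_noise N) (euclid N) (\<lambda>u. collide u v)"
  by (simp add: collision_law_def collision_noise_def collide_def case_prod_beta')

lemma thermostat_law_eq:
  "thermostat_law T N v = distr (thermostat_noise T N) (euclid N) (\<lambda>u. thermalize u v)"
  by (simp add: thermostat_law_def thermostat_noise_def thermalize_def case_prod_beta')

lemma prob_space_collision_noise: "N \<ge> 2 \<Longrightarrow> prob_space (collision_noise N)"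
  unfolding collision_noise_def
  by (intro prob_space_pair prob_space_uniform_count_measure prob_space_angle finite_ordered_pairs
      ordered_pairs_nonempty)

lemma prob_space_thermostat_noise: "N \<ge> 1 \<Longrightarrow> T > 0 \<Longrightarrow> prob_space (thermostat_noise T N)"
  unfolding thermostat_noise_def
  by (intro prob_space_pair prob_space_uniform_count_measure prob_space_angle prob_space_gaussian)
    (auto simp: lessThan_empty_iff)

section \<open>Measurability of the jump maps\<close>

lemma measurable_uniform_count_pair_left:
  assumes "countable A" "\<And>a. a \<in> A \<Longrightarrow> (\<lambda>(y, x). f a y x) \<in> measurable (M \<Otimes>\<^sub>M K) L"
  shows "(\<lambda>((a, y), x). f a y x) \<in> measurable ((uniform_count_measure A \<Otimes>\<^sub>M M) \<Otimes>\<^sub>M K) L"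
proof -
  have "(\<lambda>(a, y, x). f a y x) \<in> measurable (uniform_count_measure A \<Otimes>\<^sub>M (M \<Otimes>\<^sub>M K)) L"
    using measurable_from_uniform_count_pair[of A "\<lambda>a (y, x). f a y x", OF assms] by simp
  from measurable_compose[OF _ this,
      of "\<lambda>z. (fst (fst z), snd (fst z), snd z)" "(uniform_count_measure A \<Otimes>\<^sub>M M) \<Otimes>\<^sub>M K"]
  show ?thesis by (simp add: case_prod_beta')
qed

lemma measurable_collide:
  "(\<lambda>(u, v). collide u v) \<in> measurable (collision_noise N \<Otimes>\<^sub>M euclid N) (euclid N)"
proof -
  have "(\<lambda>((p, \<theta>), v). collide (p, \<theta>) v) \<in> measurable (collision_noise N \<Otimes>\<^sub>M euclid N) (euclid N)"
    unfolding collision_noise_def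
  proof (rule measurable_uniform_count_pair_left)
    show "countable (ordered_pairs N)"
      using finite_ordered_pairs by (rule countable_finite)
    fix p assume "p \<in> ordered_pairs N"
    then obtain i j where p: "p = (i, j)" and [measurable]: "i \<in> {..<N}" "j \<in> {..<N}"
      by (auto simp: ordered_pairs_def)
    show "(\<lambda>(\<theta>, v). collide (p, \<theta>) v) \<in> measurable (angle \<Otimes>\<^sub>M euclid N) (euclid N)"
      unfolding p collide_def case_prod_beta' fst_conv snd_conv
    proof (rule measurable_PiM_single')
      show "(\<lambda>z. ((snd z)(i := snd z i * cos (fst z) - snd z j * sin (fst z),
          j := snd z i * sin (fst z) + snd z j * cos (fst z))) k) \<in> measurable (angle \<Otimes>\<^sub>M euclid N) borel"
        if [measurable]: "k \<in> {..<N}" for k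
        unfolding fun_upd_apply by measurable
    qed (use \<open>i \<in> {..<N}\<close> \<open>j \<in> {..<N}\<close> in
        \<open>auto simp: space_pair_measure space_PiM PiE_def extensional_def\<close>)
  qed
  then show ?thesis by (simp add: case_prod_beta')
qed

lemma measurable_thermalize:
  "(\<lambda>(u, v). thermalize u v) \<in> measurable (thermostat_noise T N \<Otimes>\<^sub>M euclid N) (euclid N)"
proof -
  have "(\<lambda>((i, y), v). thermalize (i, y) v) \<in> measurable (thermostat_noise T N \<Otimes>\<^sub>M euclid N) (euclid N)"
    unfolding thermostat_noise_def
  proof (rule measurable_uniform_count_pair_left)
    fix i assume [measurable]: "i \<in> {..<N}"
    show "(\<lambda>(y, v). thermalize (i, y) v) \<in> measurable ((angle \<Otimes>\<^sub>M gaussian T) \<Otimes>\<^sub>M euclid N) (euclid N)"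
      unfolding thermalize_def case_prod_beta' fst_conv snd_conv
    proof (rule measurable_PiM_single')
      show "(\<lambda>z. ((snd z)(i := snd z i * cos (fst (fst z)) - snd (fst z) * sin (fst (fst z)))) k)
          \<in> measurable ((angle \<Otimes>\<^sub>M gaussian T) \<Otimes>\<^sub>M euclid N) borel"
        if [measurable]: "k \<in> {..<N}" for k
        unfolding fun_upd_apply by measurable
    qed (use \<open>i \<in> {..<N}\<close> in \<open>auto simp: space_pair_measure space_PiM PiE_def extensional_def\<close>)
  qed simp
  then show ?thesis by (simp add: case_prod_beta')
qed

lemma measurable_distr_noise:
  assumes "prob_space U" and G: "(\<lambda>(u, x). G u x) \<in> measurable (U \<Otimes>\<^sub>M S) S"
  shows "(\<lambda>x. distr U S (\<lambda>u. G u x)) \<in> measurable S (subprob_algebra S)"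
proof (rule measurable_distr2)
  show "case_prod (\<lambda>x u. G u x) \<in> measurable (S \<Otimes>\<^sub>M U) S"
    using measurable_compose[OF measurable_pair_swap' G] by (simp add: case_prod_beta')
  show "(\<lambda>x. U) \<in> measurable S (subprob_algebra U)"
    using assms(1) by (simp add: space_subprob_algebra prob_space_imp_subprob_space)
qed

text \<open>The jump chain acting on laws. The rates of collisions and thermostat jumps are
  \<open>lam * N\<close> and \<open>\<mu> * N\<close> in every state, so the factor \<open>N\<close>
  cancels in the probability of a collision.\<close>

definition kac_step :: "real \<Rightarrow> real \<Rightarrow> real \<Rightarrow> nat \<Rightarrow> (nat \<Rightarrow> real) measure \<Rightarrow> (nat \<Rightarrow> real) measure" where
  "kac_step lam \<mu> T N f = measure_pmf (bernoulli_pmf (lam / (lam + \<mu>))) \<bind>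
     (\<lambda>b. if b then random_step (collision_noise N) (euclid N) collide f
          else random_step (thermostat_noise T N) (euclid N) thermalize f)"

lemma emeasure_bind_measure_pmf:
  assumes "\<And>i. F i \<in> space (prob_algebra S)" "B \<in> sets S"
  shows "emeasure (measure_pmf p \<bind> F) B = (\<integral>\<^sup>+ i. emeasure (F i) B \<partial>measure_pmf p)"
  by (rule emeasure_bind[OF _ measurable_count_prob_algebra(2)[OF assms(1)] assms(2)]) simp

lemma sets_bind_measure_pmf:
  assumes "\<And>i. F i \<in> space (prob_algebra S)"
  shows "sets (measure_pmf p \<bind> F) = sets S"
  by (rule sets_bind_measurable[OF measurable_count_prob_algebra(2)[OF assms]]) simp

text \<open>The Markov property with a trivial conditioning event gives the law of
  \<open>Y (Suc n)\<close> as the average of the transition kernel under the law of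
  \<open>Y n\<close>; the kernel is a convex combination of the two jump kernels, each of which
  comes from a noise-driven map.\<close>

lemma markov_chain_kac_step:
  assumes params: "lam > 0" "\<mu> > 0" "T > 0" "N \<ge> 2" and "prob_space M"
    and Y: "markov_chain M (euclid N) (\<lambda>x B. kac_rate lam \<mu> T N x B / kac_rate lam \<mu> T N x (space (euclid N))) Y"
  shows "distr M (euclid N) (Y (Suc n)) = kac_step lam \<mu> T N (distr M (euclid N) (Y n))"
proof -
  interpret prob_space M by fact
  define K where "K x B = kac_rate lam \<mu> T N x B / kac_rate lam \<mu> T N x (space (euclid N))" for x B
  have Ym[measurable]: "Y n \<in> measurable M (euclid N)" for n
    using Y by (simp add: markov_chain_def)
  let ?f = "distr M (euclid N) (Y n)" and ?p = "lam / (lam + \<mu>)"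
  let ?C = "random_step (collision_noise N) (euclid N) collide ?f"
  let ?T = "random_step (thermostat_noise T N) (euclid N) thermalize ?f"
  have p: "0 \<le> ?p" "?p \<le> 1" using params by auto
  note Cp = prob_space_collision_noise[OF params(4)]
  have Tp: "prob_space (thermostat_noise T N)"
    using params by (intro prob_space_thermostat_noise) auto
  have f: "prob_space ?f" by (rule prob_space_distr) simp
  have F: "(if b then ?C else ?T) \<in> space (prob_algebra (euclid N))" for b
    using random_step_prob_algebra[OF Cp f _ measurable_collide]
      random_step_prob_algebra[OF Tp f _ measurable_thermalize] by auto
  have [measurable]: "(\<lambda>v. collision_law N v) \<in> measurable (euclid N) (subprob_algebra (euclid N))"
    "(\<lambda>v. thermostat_law T N v) \<in> measurable (euclid N) (subprob_algebra (euclid N))"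
    unfolding collision_law_eq thermostat_law_eq
    by (intro measurable_distr_noise Cp Tp measurable_collide measurable_thermalize)+
  have ennreal_mix: "ennreal (p * a + q * b) = ennreal a * ennreal p + ennreal b * ennreal q"
    if "0 \<le> p" "0 \<le> q" "0 \<le> a" "0 \<le> b" for p q a b :: real
    using that by (simp add: ennreal_mult mult.commute)
  show ?thesis
  proof (rule measure_eqI)
    show "sets (distr M (euclid N) (Y (Suc n))) = sets (kac_step lam \<mu> T N ?f)"
      unfolding kac_step_def sets_bind_measure_pmf[OF F] by simp
    fix B assume "B \<in> sets (distr M (euclid N) (Y (Suc n)))"
    then have B[measurable]: "B \<in> sets (euclid N)" by simp
    have K: "K v B = ?p * measure (collision_law N v) B + (1 - ?p) * measure (thermostat_law T N v) B"
      "0 \<le> K v B" "K v B \<le> 1"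
      "ennreal (K v B) = emeasure (collision_law N v) B * ?p + emeasure (thermostat_law T N v) B * (1 - ?p)"
      if v: "v \<in> space (euclid N)" for v
    proof -
      interpret C: prob_space "collision_law N v" by (rule prob_space_collision_law) fact+
      interpret T: prob_space "thermostat_law T N v"
        using params v by (intro prob_space_thermostat_law) auto
      have "1 - ?p = \<mu> / (lam + \<mu>)" using params by (simp add: field_simps)
      then show *: "K v B = ?p * measure (collision_law N v) B + (1 - ?p) * measure (thermostat_law T N v) B"
        unfolding K_def kac_rate_total[OF params(4,3) v] using params
        by (simp add: kac_rate_def add_divide_distrib)
      show "0 \<le> K v B" unfolding * by (intro add_nonneg_nonneg mult_nonneg_nonneg) (use p in auto)
      show "K v B \<le> 1" unfolding * by (rule convex_bound_le) (use p in auto)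
      show "ennreal (K v B) = emeasure (collision_law N v) B * ?p + emeasure (thermostat_law T N v) B * (1 - ?p)"
        unfolding * C.emeasure_eq_measure T.emeasure_eq_measure by (rule ennreal_mix) (use p in auto)
    qed
    \<comment> \<open>The mixture formula for \<open>K\<close> is known on the state space only, so
      measurability is transferred to it along the values of \<open>Y n\<close>.\<close>
    have KY: "(\<lambda>\<omega>. K (Y n \<omega>) B) \<in> borel_measurable M"
    proof -
      have "(\<lambda>\<omega>. ?p * measure (collision_law N (Y n \<omega>)) B + (1 - ?p) * measure (thermostat_law T N (Y n \<omega>)) B)
          \<in> borel_measurable M" by measurable
      then show ?thesis
        using K(1)[OF measurable_space[OF Ym]] by (subst measurable_cong) auto
    qed
    \<comment> \<open>The conditioning event is the whole path space up to time
      \<open>n\<close>.\<close>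
    have "{\<omega> \<in> space M. (\<lambda>k\<in>{..n}. Y k \<omega>) \<in> space (PiM {..n} (\<lambda>_. euclid N))} = space M"
      using measurable_space[OF Ym] by (auto simp: space_PiM)
    moreover have "\<forall>A\<in>sets (PiM {..n} (\<lambda>_. euclid N)). \<forall>B \<in> sets (euclid N).
        measure M {\<omega> \<in> space M. (\<lambda>k\<in>{..n}. Y k \<omega>) \<in> A \<and> Y (Suc n) \<omega> \<in> B} =
        (LINT \<omega>:{\<omega> \<in> space M. (\<lambda>k\<in>{..n}. Y k \<omega>) \<in> A}|M. K (Y n \<omega>) B)"
      using Y unfolding markov_chain_def K_def by blast
    ultimately have "measure M {\<omega> \<in> space M. Y (Suc n) \<omega> \<in> B} = (LINT \<omega>:space M|M. K (Y n \<omega>) B)"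
      using B by (metis (mono_tags, lifting) Collect_cong mem_Collect_eq sets.top)
    also have "\<dots> = (\<integral>\<omega>. K (Y n \<omega>) B \<partial>M)"
      unfolding set_lebesgue_integral_def by (intro Bochner_Integration.integral_cong) auto
    finally have "measure M {\<omega> \<in> space M. Y (Suc n) \<omega> \<in> B} = (\<integral>\<omega>. K (Y n \<omega>) B \<partial>M)" .
    moreover have "Y (Suc n) -` B \<inter> space M = {\<omega> \<in> space M. Y (Suc n) \<omega> \<in> B}"
      by auto
    ultimately have "emeasure (distr M (euclid N) (Y (Suc n))) B = ennreal (\<integral>\<omega>. K (Y n \<omega>) B \<partial>M)"
      by (simp add: emeasure_distr emeasure_eq_measure)
    also have "\<dots> = (\<integral>\<^sup>+ \<omega>. ennreal (K (Y n \<omega>) B) \<partial>M)"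
      using K(2,3)[OF measurable_space[OF Ym]] KY
      by (intro nn_integral_eq_integral[symmetric] integrable_const_bound[where B = 1]) auto
    also have "\<dots> = (\<integral>\<^sup>+ \<omega>. emeasure (collision_law N (Y n \<omega>)) B * ?p +
        emeasure (thermostat_law T N (Y n \<omega>)) B * (1 - ?p) \<partial>M)"
      by (intro nn_integral_cong K(4) measurable_space[OF Ym])
    also have "\<dots> = (\<integral>\<^sup>+ v. emeasure (collision_law N v) B * ?p +
        emeasure (thermostat_law T N v) B * (1 - ?p) \<partial>?f)"
      by (rule nn_integral_distr[symmetric]) measurable
    also have "\<dots> = (\<integral>\<^sup>+ v. emeasure (collision_law N v) B \<partial>?f) * ?p +
        (\<integral>\<^sup>+ v. emeasure (thermostat_law T N v) B \<partial>?f) * (1 - ?p)"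
      by (subst nn_integral_add) (auto simp: nn_integral_multc)
    also have "\<dots> = emeasure ?C B * ?p + emeasure ?T B * (1 - ?p)"
      unfolding collision_law_eq thermostat_law_eq
      using emeasure_random_step[OF Cp f _ measurable_collide B]
        emeasure_random_step[OF Tp f _ measurable_thermalize B] by simp
    also have "\<dots> = emeasure (kac_step lam \<mu> T N ?f) B"
      unfolding kac_step_def using p by (subst emeasure_bind_measure_pmf[OF F B]) simp
    finally show "emeasure (distr M (euclid N) (Y (Suc n))) B = emeasure (kac_step lam \<mu> T N ?f) B" .
  qed
qed


section \<open>Contraction of the transport cost in one jump\<close>

text \<open>Both configurations are rotated by the same angle in the same coordinate plane, so their
  difference is rotated too and keeps its length.\<close>

lemma sum_collide_power2:
  assumes "(i, j) \<in> ordered_pairs N"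
  shows "(\<Sum>k<N. (collide ((i, j), \<theta>) x k - collide ((i, j), \<theta>) y k)\<^sup>2) = (\<Sum>k<N. (x k - y k)\<^sup>2)"
proof -
  have ij: "i \<in> {..<N}" "j \<in> {..<N} - {i}" "i \<noteq> j"
    using assms by (auto simp: ordered_pairs_def)
  have split: "sum h {..<N} = h i + (h j + sum h ({..<N} - {i} - {j}))" for h :: "nat \<Rightarrow> real"
    using ij by (simp add: sum.remove[of _ i] sum.remove[of _ j])
  define a b where "a = x i - y i" and "b = x j - y j"
  have "(a * cos \<theta> - b * sin \<theta>)\<^sup>2 + (a * sin \<theta> + b * cos \<theta>)\<^sup>2 = (a\<^sup>2 + b\<^sup>2) * ((sin \<theta>)\<^sup>2 + (cos \<theta>)\<^sup>2)"
    by algebra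
  also have "\<dots> = a\<^sup>2 + b\<^sup>2"
    by simp
  finally have rot: "(collide ((i, j), \<theta>) x i - collide ((i, j), \<theta>) y i)\<^sup>2 +
      (collide ((i, j), \<theta>) x j - collide ((i, j), \<theta>) y j)\<^sup>2 = (x i - y i)\<^sup>2 + (x j - y j)\<^sup>2"
    using ij by (simp add: collide_def a_def b_def algebra_simps)
  have "(\<Sum>k\<in>{..<N} - {i} - {j}. (collide ((i, j), \<theta>) x k - collide ((i, j), \<theta>) y k)\<^sup>2) =
      (\<Sum>k\<in>{..<N} - {i} - {j}. (x k - y k)\<^sup>2)"
    by (rule sum.cong) (auto simp: collide_def)
  then show ?thesis
    using rot by (simp add: split)
qed

text \<open>The shared \<open>w\<close> cancels in the difference, leaving the factor
  \<open>cos \<theta>\<close> on coordinate \<open>i\<close>. The untouched coordinates are written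
  as the full sum minus one term, ready for averaging over \<open>i\<close>.\<close>

lemma sum_thermalize_power2:
  assumes "i < N"
  shows "(\<Sum>k<N. (thermalize (i, \<theta>, w) x k - thermalize (i, \<theta>, w) y k)\<^sup>2) =
    ((\<Sum>k<N. (x k - y k)\<^sup>2) - (x i - y i)\<^sup>2) + (x i - y i)\<^sup>2 * (cos \<theta>)\<^sup>2"
proof -
  have "(\<Sum>k\<in>{..<N} - {i}. (thermalize (i, \<theta>, w) x k - thermalize (i, \<theta>, w) y k)\<^sup>2) =
      (\<Sum>k\<in>{..<N} - {i}. (x k - y k)\<^sup>2)"
    by (rule sum.cong) (auto simp: thermalize_def)
  moreover have "thermalize (i, \<theta>, w) x i - thermalize (i, \<theta>, w) y i = (x i - y i) * cos \<theta>"
    by (simp add: thermalize_def algebra_simps)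
  ultimately show ?thesis
    using assms by (simp add: sum.remove[of _ i] power_mult_distrib)
qed

lemma nn_integral_angle_cos_power2: "(\<integral>\<^sup>+ \<theta>. ennreal ((cos \<theta>)\<^sup>2) \<partial>angle) = ennreal (1 / 2)"
proof -
  \<comment> \<open>The half-open interval is closed at the cost of a null set. The antiderivative
    \<open>\<theta> / 2 + sin \<theta> * cos \<theta> / 2\<close> then gives \<open>pi\<close>, to
    be divided by the length \<open>2 * pi\<close>.\<close>
  have "(\<integral>\<^sup>+ \<theta>. ennreal ((cos \<theta>)\<^sup>2) * indicator {0..<2 * pi} \<theta> \<partial>lborel) =
      (\<integral>\<^sup>+ \<theta>. ennreal ((cos \<theta>)\<^sup>2) * indicator {0..2 * pi} \<theta> \<partial>lborel)"
    using AE_lborel_singleton[of "2 * pi"]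
    by (intro nn_integral_cong_AE, eventually_elim) (auto simp: indicator_def)
  also have "\<dots> = ennreal ((2 * pi / 2 + sin (2 * pi) * cos (2 * pi) / 2) - (0 / 2 + sin 0 * cos 0 / 2))"
  proof (rule nn_integral_FTC_Icc)
    fix \<theta> :: real
    have "1 / 2 + (cos \<theta> * cos \<theta> - sin \<theta> * sin \<theta>) / 2 = (cos \<theta>)\<^sup>2"
      using sin_cos_squared_add[of \<theta>] by (simp add: power2_eq_square field_simps)
    then show "DERIV (\<lambda>\<theta>. \<theta> / 2 + sin \<theta> * cos \<theta> / 2) \<theta> :> (cos \<theta>)\<^sup>2"
      by (auto intro!: derivative_eq_intros simp: field_simps)
  qed auto
  finally show ?thesis
    unfolding angle_def
    by (subst nn_integral_uniform_measure) (auto simp: divide_ennreal)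
qed

lemma nn_integral_uniform_count_measure:
  "finite A \<Longrightarrow> (\<integral>\<^sup>+ a. f a \<partial>uniform_count_measure A) = (\<Sum>a\<in>A. ennreal (1 / card A) * f a)"
  unfolding uniform_count_measure_def by (rule nn_integral_point_measure_finite)

text \<open>The cost is preserved for each value of the noise, so averaging over the noise changes
  nothing.\<close>

lemma transport_cost_collide:
  assumes "P \<in> couplings N f g" "N \<ge> 2"
  shows "transport_cost N (synchronous_step (collision_noise N) (euclid N) collide P) = transport_cost N P"
proof -
  interpret U: prob_space "collision_noise N"
    using assms by (intro prob_space_collision_noise)
  have "(\<integral>\<^sup>+ u. ennreal (1 / real N * (\<Sum>k<N. (collide u x k - collide u y k)\<^sup>2)) \<partial>collision_noise N) =
      (\<integral>\<^sup>+ u. ennreal (1 / real N * (\<Sum>k<N. (x k - y k)\<^sup>2)) \<partial>collision_noise N)" for x y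
    by (intro nn_integral_cong)
      (auto simp: collision_noise_def space_pair_measure space_uniform_count_measure sum_collide_power2)
  then show ?thesis
    unfolding transport_cost_def
    by (subst nn_integral_synchronous_step[OF U.prob_space_axioms couplingsD(1,2)[OF assms(1)]
          measurable_collide measurable_transport_cost])
      (simp add: U.emeasure_space_1)
qed

text \<open>With \<open>S\<close> the sum of squared differences, averaging over the angle removes
  half of the chosen term, and averaging over the uniform index replaces that term by
  \<open>S / N\<close>. The expected loss is \<open>S / (2 * N)\<close>.\<close>

lemma transport_cost_thermalize:
  assumes "P \<in> couplings N f g" "N \<ge> 1" "T > 0"
  shows "transport_cost N (synchronous_step (thermostat_noise T N) (euclid N) thermalize P) =
    ennreal (1 - 1 / (2 * real N)) * transport_cost N P"
proof -
  interpret U: prob_space "thermostat_noise T N"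
    using assms by (intro prob_space_thermostat_noise)
  interpret A: prob_space angle by (rule prob_space_angle)
  interpret G: prob_space "gaussian T" by (rule prob_space_gaussian) fact
  interpret AG: pair_prob_space angle "gaussian T" ..
  let ?N = "1 / real N"
  have noise: "(\<integral>\<^sup>+ u. ennreal (?N * (\<Sum>k<N. (thermalize u x k - thermalize u y k)\<^sup>2)) \<partial>thermostat_noise T N) =
      ennreal (1 - 1 / (2 * real N)) * ennreal (?N * (\<Sum>k<N. (x k - y k)\<^sup>2))" for x y
  proof -
    define S where "S = (\<Sum>k<N. (x k - y k)\<^sup>2)"
    \<comment> \<open>This keeps the differences below nonnegative, where \<open>ennreal\<close> is
      compatible with sums and products instead of truncating to 0.\<close>
    have Si: "(x i - y i)\<^sup>2 \<le> S" if "i < N" for i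
      unfolding S_def using that by (intro member_le_sum) auto
    have "(\<integral>\<^sup>+ u. ennreal (?N * (\<Sum>k<N. (thermalize u x k - thermalize u y k)\<^sup>2)) \<partial>thermostat_noise T N) =
        (\<integral>\<^sup>+ u. (case u of (i, \<theta>, w) \<Rightarrow>
          ennreal (?N * (S - (x i - y i)\<^sup>2)) + ennreal (?N * (x i - y i)\<^sup>2) * ennreal ((cos \<theta>)\<^sup>2)) \<partial>thermostat_noise T N)"
    proof (intro nn_integral_cong, clarify)
      fix i \<theta> w assume "(i, \<theta>, w) \<in> space (thermostat_noise T N)"
      then have i: "i < N"
        by (simp add: thermostat_noise_def space_pair_measure space_uniform_count_measure)
      show "ennreal (?N * (\<Sum>k<N. (thermalize (i, \<theta>, w) x k - thermalize (i, \<theta>, w) y k)\<^sup>2)) =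
          ennreal (?N * (S - (x i - y i)\<^sup>2)) + ennreal (?N * (x i - y i)\<^sup>2) * ennreal ((cos \<theta>)\<^sup>2)"
        unfolding sum_thermalize_power2[OF i] S_def[symmetric] using Si[OF i]
        by (simp add: ennreal_mult[symmetric] ennreal_plus[symmetric] distrib_left del: ennreal_plus)
    qed
    also have "\<dots> = (\<integral>\<^sup>+ i. (\<integral>\<^sup>+ (\<theta>, w). ennreal (?N * (S - (x i - y i)\<^sup>2)) +
          ennreal (?N * (x i - y i)\<^sup>2) * ennreal ((cos \<theta>)\<^sup>2) \<partial>(angle \<Otimes>\<^sub>M gaussian T)) \<partial>uniform_count_measure {..<N})"
      unfolding thermostat_noise_def
      by (subst AG.nn_integral_fst[symmetric])
        (auto simp: case_prod_beta' intro!: measurable_from_uniform_count_pair[unfolded case_prod_beta'])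
    also have "\<dots> = (\<integral>\<^sup>+ i. ennreal (?N * (S - (x i - y i)\<^sup>2)) +
          ennreal (?N * (x i - y i)\<^sup>2) * ennreal (1 / 2) \<partial>uniform_count_measure {..<N})"
      by (intro nn_integral_cong)
        (simp add: G.nn_integral_fst[symmetric] case_prod_beta' G.emeasure_space_1 AG.P.emeasure_space_1
          nn_integral_add nn_integral_cmult nn_integral_angle_cos_power2)
    also have "\<dots> = (\<Sum>i<N. ennreal (?N * (?N * (S - (x i - y i)\<^sup>2 / 2))))"
      unfolding nn_integral_uniform_count_measure[OF finite_lessThan] card_lessThan
    proof (rule sum.cong[OF refl])
      fix i assume "i \<in> {..<N}"
      moreover have "ennreal a * (ennreal p + ennreal q * ennreal (1 / 2)) = ennreal (a * (p + q / 2))"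
        if "0 \<le> a" "0 \<le> p" "0 \<le> q" for a p q
        using that by (simp only: ennreal_mult[symmetric] ennreal_plus[symmetric]) simp
      ultimately have "ennreal ?N * (ennreal (?N * (S - (x i - y i)\<^sup>2)) + ennreal (?N * (x i - y i)\<^sup>2) * ennreal (1 / 2)) =
          ennreal (?N * (?N * (S - (x i - y i)\<^sup>2) + ?N * (x i - y i)\<^sup>2 / 2))"
        using Si by auto
      also have "?N * (S - (x i - y i)\<^sup>2) + ?N * (x i - y i)\<^sup>2 / 2 = ?N * (S - (x i - y i)\<^sup>2 / 2)"
        by (simp add: right_diff_distrib)
      finally show "ennreal ?N * (ennreal (?N * (S - (x i - y i)\<^sup>2)) + ennreal (?N * (x i - y i)\<^sup>2) * ennreal (1 / 2)) =
          ennreal (?N * (?N * (S - (x i - y i)\<^sup>2 / 2)))" .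
    qed
    also have "\<dots> = ennreal (\<Sum>i<N. ?N * (?N * (S - (x i - y i)\<^sup>2 / 2)))"
    proof (intro sum_ennreal mult_nonneg_nonneg)
      show "0 \<le> S - (x i - y i)\<^sup>2 / 2" if "i \<in> {..<N}" for i
        using Si[OF that[unfolded lessThan_iff]] zero_le_power2[of "x i - y i"] by linarith
    qed auto
    also have "(\<Sum>i<N. ?N * (?N * (S - (x i - y i)\<^sup>2 / 2))) = ?N * (?N * (real N * S - S / 2))"
      by (simp add: sum_distrib_left[symmetric] sum_subtractf sum_divide_distrib[symmetric] S_def[symmetric])
    also have "\<dots> = (1 - 1 / (2 * real N)) * (?N * S)"
      using assms(2) by (simp add: field_simps)
    also have "ennreal \<dots> = ennreal (1 - 1 / (2 * real N)) * ennreal (?N * S)"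
      using assms(2) by (intro ennreal_mult) (auto simp: S_def sum_nonneg)
    finally show ?thesis
      unfolding S_def .
  qed
  have c: "(\<lambda>(x, y). ennreal (?N * (\<Sum>k<N. (x k - y k)\<^sup>2))) \<in> borel_measurable P"
    using measurable_transport_cost measurable_cong_sets[OF couplingsD(2)[OF assms(1)] refl] by blast
  have "transport_cost N (synchronous_step (thermostat_noise T N) (euclid N) thermalize P) =
      (\<integral>\<^sup>+ (x, y). ennreal (1 - 1 / (2 * real N)) * ennreal (?N * (\<Sum>k<N. (x k - y k)\<^sup>2)) \<partial>P)"
    unfolding transport_cost_def
    by (subst nn_integral_synchronous_step[OF U.prob_space_axioms couplingsD(1,2)[OF assms(1)]
          measurable_thermalize measurable_transport_cost]) (simp only: noise)
  also have "\<dots> = ennreal (1 - 1 / (2 * real N)) * transport_cost N P"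
    unfolding transport_cost_def
    using nn_integral_cmult[OF c, of "ennreal (1 - 1 / (2 * real N))"] by (simp add: case_prod_beta')
  finally show ?thesis .
qed


section \<open>Invariance of the Gaussian product law\<close>

lemma nn_integral_gaussian:
  "f \<in> borel_measurable borel \<Longrightarrow>
    (\<integral>\<^sup>+ x. f x \<partial>gaussian T) = (\<integral>\<^sup>+ x. ennreal (normal_density 0 (sqrt T) x) * f x \<partial>lborel)"
  unfolding gaussian_def by (rule nn_integral_density) auto

text \<open>A product of two centered Gaussian densities of equal variance depends on the point only
  through its Euclidean norm.\<close>

lemma normal_density_rotation:
  assumes "x\<^sup>2 + y\<^sup>2 = a\<^sup>2 + b\<^sup>2"
  shows "normal_density 0 \<sigma> x * normal_density 0 \<sigma> y = normal_density 0 \<sigma> a * normal_density 0 \<sigma> b"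
proof -
  have "exp (- x\<^sup>2 / (2 * \<sigma>\<^sup>2)) * exp (- y\<^sup>2 / (2 * \<sigma>\<^sup>2)) = exp (- a\<^sup>2 / (2 * \<sigma>\<^sup>2)) * exp (- b\<^sup>2 / (2 * \<sigma>\<^sup>2))"
    unfolding exp_add[symmetric] add_divide_distrib[symmetric] minus_add_distrib[symmetric]
    using assms by (simp add: add.commute)
  then show ?thesis
    by (simp add: normal_density_def)
qed

lemma nn_integral_gaussian_uminus:
  assumes [measurable]: "f \<in> borel_measurable borel"
  shows "(\<integral>\<^sup>+ x. f (- x) \<partial>gaussian T) = (\<integral>\<^sup>+ x. f x \<partial>gaussian T)"
  using nn_integral_real_affine[where c = "-1" and t = 0
      and f = "\<lambda>x. ennreal (normal_density 0 (sqrt T) x) * f x"]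
  by (simp add: nn_integral_gaussian normal_density_def)

text \<open>The rotation is factored into two one-dimensional affine substitutions with an exchange
  of integrals in between. Both divide by \<open>s\<close>, so the case \<open>s = 0\<close>, where
  the rotation is plus or minus the identity, is settled first by the symmetry of the
  density.\<close>

lemma nn_integral_gaussian_rotation:
  fixes c s :: real
  assumes T: "T > 0" and cs: "c\<^sup>2 + s\<^sup>2 = 1" and [measurable]: "(\<lambda>(x, y). f x y) \<in> borel_measurable (borel \<Otimes>\<^sub>M borel)"
  shows "(\<integral>\<^sup>+ x. \<integral>\<^sup>+ y. f (x * c - y * s) (x * s + y * c) \<partial>gaussian T \<partial>gaussian T) =
    (\<integral>\<^sup>+ x. \<integral>\<^sup>+ y. f x y \<partial>gaussian T \<partial>gaussian T)"
proof (cases "s = 0")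
  case True
  then consider "c = 1" | "c = -1"
    using cs by (auto simp: power2_eq_1_iff)
  then show ?thesis
  proof cases
    case 2
    have "sigma_finite_measure (gaussian T)"
      using prob_space_gaussian[OF T] by (rule prob_space_imp_sigma_finite)
    then have [measurable]: "(\<lambda>x. \<integral>\<^sup>+ y. f x y \<partial>gaussian T) \<in> borel_measurable borel"
      by (rule sigma_finite_measure.borel_measurable_nn_integral) measurable
    show ?thesis
      using True 2 nn_integral_gaussian_uminus[of "\<lambda>x. \<integral>\<^sup>+ y. f x y \<partial>gaussian T" T]
      by (simp add: nn_integral_gaussian_uminus)
  qed (use True in simp)
next
  case False
  define p where "p x = normal_density 0 (sqrt T) x" for x
  have [measurable]: "p \<in> borel_measurable borel" and p0: "\<And>x. 0 \<le> p x"
    unfolding p_def by auto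
  have double: "(\<integral>\<^sup>+ x. \<integral>\<^sup>+ y. h x y \<partial>gaussian T \<partial>gaussian T) =
      (\<integral>\<^sup>+ x. \<integral>\<^sup>+ y. ennreal (p x * p y) * h x y \<partial>lborel \<partial>lborel)"
    if [measurable]: "(\<lambda>(x, y). h x y) \<in> borel_measurable (borel \<Otimes>\<^sub>M borel)" for h
  proof -
    have "(\<integral>\<^sup>+ y. h x y \<partial>gaussian T) = (\<integral>\<^sup>+ y. ennreal (p y) * h x y \<partial>lborel)" for x
      unfolding p_def by (rule nn_integral_gaussian) measurable
    then show ?thesis
      by (subst nn_integral_gaussian)
        (auto simp: p_def[symmetric] nn_integral_cmult[symmetric] ennreal_mult p0 mult.assoc)
  qed
  have "(\<integral>\<^sup>+ x. \<integral>\<^sup>+ y. f (x * c - y * s) (x * s + y * c) \<partial>gaussian T \<partial>gaussian T) =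
      (\<integral>\<^sup>+ x. \<integral>\<^sup>+ y. ennreal (p x * p y) * f (x * c - y * s) (x * s + y * c) \<partial>lborel \<partial>lborel)"
    by (rule double) measurable
  \<comment> \<open>For fixed \<open>x\<close>, the variable \<open>u = x * c - y * s\<close>
    replaces \<open>y\<close>; the other argument of \<open>f\<close> becomes
    \<open>(x - c * u) / s\<close> because \<open>c^2 + s^2 = 1\<close>.\<close>
  also have "\<dots> = (\<integral>\<^sup>+ x. \<integral>\<^sup>+ u. ennreal \<bar>1 / s\<bar> * (ennreal (p x * p (x * c / s - u / s)) * f u ((x - c * u) / s)) \<partial>lborel \<partial>lborel)"
  proof (rule nn_integral_cong)
    fix x :: real
    have "x * c - (x * c / s - u / s) * s = u" "x * s + (x * c / s - u / s) * c = (x - c * u) / s" for u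
    proof -
      show "x * c - (x * c / s - u / s) * s = u"
        using False by (simp add: field_simps)
      have "x * s * s + (x * c - u) * c = x * (c\<^sup>2 + s\<^sup>2) - c * u"
        by algebra
      then show "x * s + (x * c / s - u / s) * c = (x - c * u) / s"
        unfolding cs using False by (simp add: field_simps)
    qed
    then show "(\<integral>\<^sup>+ y. ennreal (p x * p y) * f (x * c - y * s) (x * s + y * c) \<partial>lborel) =
       (\<integral>\<^sup>+ u. ennreal \<bar>1 / s\<bar> * (ennreal (p x * p (x * c / s - u / s)) * f u ((x - c * u) / s)) \<partial>lborel)"
      using False
      by (subst nn_integral_real_affine[where c = "- 1 / s" and t = "x * c / s"])
        (simp_all add: nn_integral_cmult)
  qed
  also have "\<dots> = (\<integral>\<^sup>+ u. \<integral>\<^sup>+ x. ennreal \<bar>1 / s\<bar> * (ennreal (p x * p (x * c / s - u / s)) * f u ((x - c * u) / s)) \<partial>lborel \<partial>lborel)"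
    by (rule lborel_pair.Fubini') measurable
  \<comment> \<open>For fixed \<open>u\<close>, the variable \<open>z\<close> with
    \<open>x = c * u + s * z\<close> replaces \<open>x\<close>. Its Jacobian cancels the factor
    \<open>1 / s\<close> up to sign, and the product density at the old point equals that at
    \<open>(u, z)\<close>.\<close>
  also have "\<dots> = (\<integral>\<^sup>+ u. \<integral>\<^sup>+ z. ennreal (p u * p z) * f u z \<partial>lborel \<partial>lborel)"
  proof (rule nn_integral_cong)
    fix u :: real
    have arg: "(c * u + s * z) * c / s - u / s = c * z - s * u" for z
    proof -
      have "(c * u + s * z) * c - u = s * (c * z) - u * (1 - c\<^sup>2)"
        by algebra
      also have "1 - c\<^sup>2 = s\<^sup>2"
        using cs by simp
      also have "s * (c * z) - u * s\<^sup>2 = s * (c * z - s * u)"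
        by algebra
      finally show ?thesis
        using False by (simp add: diff_divide_distrib[symmetric])
    qed
    have dens: "p (c * u + s * z) * p (c * z - s * u) = p u * p z" for z
    proof -
      have "(c * u + s * z)\<^sup>2 + (c * z - s * u)\<^sup>2 = (c\<^sup>2 + s\<^sup>2) * (u\<^sup>2 + z\<^sup>2)"
        by algebra
      then show ?thesis
        unfolding p_def cs by (intro normal_density_rotation) simp
    qed
    have unit: "ennreal \<bar>s\<bar> * (ennreal \<bar>1 / s\<bar> * a) = a" for a
      using False by (simp add: mult.assoc[symmetric] ennreal_mult[symmetric] del: abs_divide)
        (simp add: abs_mult[symmetric])
    have "(\<integral>\<^sup>+ x. ennreal \<bar>1 / s\<bar> * (ennreal (p x * p (x * c / s - u / s)) * f u ((x - c * u) / s)) \<partial>lborel) =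
        ennreal \<bar>s\<bar> * (\<integral>\<^sup>+ z. ennreal \<bar>1 / s\<bar> * (ennreal (p u * p z) * f u z) \<partial>lborel)"
      using False by (subst nn_integral_real_affine[where c = s and t = "c * u"]) (simp_all add: arg dens)
    then show "(\<integral>\<^sup>+ x. ennreal \<bar>1 / s\<bar> * (ennreal (p x * p (x * c / s - u / s)) * f u ((x - c * u) / s)) \<partial>lborel) =
        (\<integral>\<^sup>+ z. ennreal (p u * p z) * f u z \<partial>lborel)"
      by (simp add: nn_integral_cmult unit del: abs_divide)
  qed
  also have "\<dots> = (\<integral>\<^sup>+ x. \<integral>\<^sup>+ y. f x y \<partial>gaussian T \<partial>gaussian T)"
    by (rule double[symmetric]) measurable
  finally show ?thesis .
qed

section \<open>Isolating coordinates of the Gaussian product law\<close>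

abbreviation (input) gaussian_product :: "real \<Rightarrow> nat \<Rightarrow> (nat \<Rightarrow> real) measure" where
  "gaussian_product T N \<equiv> PiM {..<N} (\<lambda>_. gaussian T)"

lemma sets_gaussian_product: "sets (gaussian_product T N) = sets (euclid N)"
  by (intro sets_PiM_cong) (auto simp: sets_gaussian)

lemma measurable_PiM_gaussian:
  "measurable (PiM I (\<lambda>_. gaussian T)) L = measurable (PiM I (\<lambda>_. borel)) L"
  by (intro measurable_cong_sets sets_PiM_cong) (auto simp: sets_gaussian)

lemma nn_integral_gaussian_product_insert:
  fixes i :: nat
  assumes T: "T > 0" and "finite I" "i \<notin> I" and h: "h \<in> borel_measurable (PiM (insert i I) (\<lambda>_. borel))"
  shows "(\<integral>\<^sup>+ x. h x \<partial>PiM (insert i I) (\<lambda>_. gaussian T)) =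
    (\<integral>\<^sup>+ a. \<integral>\<^sup>+ x. h (x(i := a)) \<partial>PiM I (\<lambda>_. gaussian T) \<partial>gaussian T)"
proof -
  interpret G: prob_space "gaussian T" using T by (rule prob_space_gaussian)
  interpret product_sigma_finite "\<lambda>_::nat. gaussian T" ..
  show ?thesis
    using h assms(2,3) by (intro product_nn_integral_insert_rev) (simp_all add: measurable_PiM_gaussian)
qed

lemma prob_space_PiM_gaussian: "T > 0 \<Longrightarrow> prob_space (PiM I (\<lambda>_. gaussian T))"
  by (intro prob_space_PiM prob_space_gaussian)

lemma measurable_fun_upd_borel:
  "(\<lambda>(a, x). x(i := a)) \<in> measurable (borel \<Otimes>\<^sub>M PiM I (\<lambda>_. gaussian T)) (PiM (insert i I) (\<lambda>_. borel))"
proof -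
  have "sets (borel \<Otimes>\<^sub>M PiM I (\<lambda>_. gaussian T)) = sets (borel \<Otimes>\<^sub>M PiM I (\<lambda>_. borel :: real measure))"
    by (intro sets_pair_measure_cong sets_PiM_cong refl) (simp add: sets_gaussian)
  then show ?thesis
    unfolding case_prod_beta' by (subst measurable_cong_sets[OF _ refl], assumption)
      (intro measurable_fun_upd[where J = I]; simp)
qed

text \<open>Integrating out all coordinates except \<open>i\<close> and \<open>j\<close> leaves a
  function \<open>H\<close> of two independent Gaussians, on whose arguments the collision acts as a
  planar rotation. The invariance thus holds for each fixed pair and angle.\<close>

lemma nn_integral_collide_gaussian_product:
  assumes T: "T > 0" and ij: "(i, j) \<in> ordered_pairs N" and h[measurable]: "h \<in> borel_measurable (euclid N)"
  shows "(\<integral>\<^sup>+ v. h (collide ((i, j), \<theta>) v) \<partial>gaussian_product T N) = (\<integral>\<^sup>+ v. h v \<partial>gaussian_product T N)"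
proof -
  define I where "I = {..<N} - {i, j}"
  have N: "{..<N} = insert i (insert j I)" and I: "finite I" "j \<notin> I" "i \<notin> insert j I" "i \<noteq> j"
    using ij by (auto simp: I_def ordered_pairs_def)
  let ?PI = "PiM I (\<lambda>_. gaussian T)"
  interpret PI: prob_space ?PI using T by (rule prob_space_PiM_gaussian)
  have upd[measurable]: "(\<lambda>x. x(i := a)) \<in> measurable (PiM (insert j I) (\<lambda>_. borel)) (euclid N)" for a :: real
    unfolding N by (intro measurable_fun_upd[where J = "insert j I"]) auto
  have split: "(\<integral>\<^sup>+ v. F v \<partial>gaussian_product T N) =
      (\<integral>\<^sup>+ a. \<integral>\<^sup>+ b. \<integral>\<^sup>+ x. F (x(j := b, i := a)) \<partial>?PI \<partial>gaussian T \<partial>gaussian T)"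
    if [measurable]: "F \<in> borel_measurable (euclid N)" for F :: "(nat \<Rightarrow> real) \<Rightarrow> ennreal"
  proof -
    have "(\<integral>\<^sup>+ v. F v \<partial>gaussian_product T N) =
        (\<integral>\<^sup>+ a. \<integral>\<^sup>+ x. F (x(i := a)) \<partial>PiM (insert j I) (\<lambda>_. gaussian T) \<partial>gaussian T)"
      unfolding N using that[unfolded N] I by (intro nn_integral_gaussian_product_insert T) auto
    also have "\<dots> = (\<integral>\<^sup>+ a. \<integral>\<^sup>+ b. \<integral>\<^sup>+ x. F (x(j := b, i := a)) \<partial>?PI \<partial>gaussian T \<partial>gaussian T)"
      using I by (intro nn_integral_cong nn_integral_gaussian_product_insert T) auto
    finally show ?thesis .
  qed
  have [measurable]: "collide ((i, j), \<theta>) \<in> measurable (euclid N) (euclid N)"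
    using measurable_Pair2[OF measurable_collide, of "((i, j), \<theta>)" N] ij
    by (simp add: collision_noise_def space_pair_measure space_uniform_count_measure angle_def)
  define H where "H a b = (\<integral>\<^sup>+ x. h (x(j := b, i := a)) \<partial>?PI)" for a b
  have [measurable]: "(\<lambda>(a, b). H a b) \<in> borel_measurable (borel \<Otimes>\<^sub>M borel)"
  proof -
    have "(\<lambda>z. (snd z)(j := snd (fst z), i := fst (fst z))) \<in>
        measurable ((borel \<Otimes>\<^sub>M borel) \<Otimes>\<^sub>M PiM I (\<lambda>_. borel)) (euclid N)"
      unfolding N by (intro measurable_fun_upd[where J = "insert j I"] measurable_fun_upd[where J = I])
        (auto intro: measurable_compose[OF measurable_fst])
    from measurable_compose[OF this h]
    have "(\<lambda>(z, x). h (x(j := snd z, i := fst z))) \<in> borel_measurable ((borel \<Otimes>\<^sub>M borel) \<Otimes>\<^sub>M ?PI)"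
      by (simp add: case_prod_beta' cong: measurable_cong_sets sets_pair_measure_cong sets_PiM_cong)
    then show ?thesis
      unfolding H_def case_prod_beta' by (intro PI.borel_measurable_nn_integral) (simp add: case_prod_beta')
  qed
  have "(\<integral>\<^sup>+ v. h (collide ((i, j), \<theta>) v) \<partial>gaussian_product T N) =
      (\<integral>\<^sup>+ a. \<integral>\<^sup>+ b. H (a * cos \<theta> - b * sin \<theta>) (a * sin \<theta> + b * cos \<theta>) \<partial>gaussian T \<partial>gaussian T)"
  proof (subst split)
    \<comment> \<open>The collision overwrites both old values; its updates come in the opposite
      order to those in \<open>H\<close> and commute because \<open>i \<noteq> j\<close>.\<close>
    have "(x(j := b, i := a))(i := a * cos \<theta> - b * sin \<theta>, j := a * sin \<theta> + b * cos \<theta>) =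
        x(j := a * sin \<theta> + b * cos \<theta>, i := a * cos \<theta> - b * sin \<theta>)" for x :: "nat \<Rightarrow> real" and a b
      using \<open>i \<noteq> j\<close> by (auto simp: fun_eq_iff)
    then show "(\<integral>\<^sup>+ a. \<integral>\<^sup>+ b. \<integral>\<^sup>+ x. h (collide ((i, j), \<theta>) (x(j := b, i := a))) \<partial>?PI \<partial>gaussian T \<partial>gaussian T) =
      (\<integral>\<^sup>+ a. \<integral>\<^sup>+ b. H (a * cos \<theta> - b * sin \<theta>) (a * sin \<theta> + b * cos \<theta>) \<partial>gaussian T \<partial>gaussian T)"
      using \<open>i \<noteq> j\<close> by (simp add: H_def collide_def)
  qed measurable
  also have "\<dots> = (\<integral>\<^sup>+ a. \<integral>\<^sup>+ b. H a b \<partial>gaussian T \<partial>gaussian T)"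
    by (rule nn_integral_gaussian_rotation[OF T]) auto
  also have "\<dots> = (\<integral>\<^sup>+ v. h v \<partial>gaussian_product T N)"
    unfolding H_def by (rule split[symmetric]) measurable
  finally show ?thesis .
qed

text \<open>For a fixed angle the velocity of particle \<open>i\<close> and the bath velocity
  \<open>w\<close> form a planar Gaussian, and the new velocity is the first coordinate of its
  rotation. Invariance therefore needs the average over \<open>w\<close>.\<close>

lemma nn_integral_thermalize_gaussian_product:
  assumes T: "T > 0" and i: "i < N" and h[measurable]: "h \<in> borel_measurable (euclid N)"
  shows "(\<integral>\<^sup>+ w. \<integral>\<^sup>+ v. h (thermalize (i, \<theta>, w) v) \<partial>gaussian_product T N \<partial>gaussian T) =
    (\<integral>\<^sup>+ v. h v \<partial>gaussian_product T N)"
proof -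
  define I where "I = {..<N} - {i}"
  have N: "{..<N} = insert i I" and I: "finite I" "i \<notin> I"
    using i by (auto simp: I_def)
  let ?PI = "PiM I (\<lambda>_. gaussian T)"
  interpret PI: prob_space ?PI using T by (rule prob_space_PiM_gaussian)
  interpret G: prob_space "gaussian T" using T by (rule prob_space_gaussian)
  interpret GG: pair_sigma_finite "gaussian T" "gaussian T" ..
  have split: "(\<integral>\<^sup>+ v. F v \<partial>gaussian_product T N) = (\<integral>\<^sup>+ a. \<integral>\<^sup>+ x. F (x(i := a)) \<partial>?PI \<partial>gaussian T)"
    if "F \<in> borel_measurable (euclid N)" for F :: "(nat \<Rightarrow> real) \<Rightarrow> ennreal"
    unfolding N using that[unfolded N] I by (intro nn_integral_gaussian_product_insert T) auto
  have [measurable]: "thermalize (i, \<theta>, w) \<in> measurable (euclid N) (euclid N)" for w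
    using measurable_Pair2[OF measurable_thermalize, of "(i, \<theta>, w)" T N] i
    by (simp add: thermostat_noise_def space_pair_measure space_uniform_count_measure angle_def gaussian_def)
  define H where "H a = (\<integral>\<^sup>+ x. h (x(i := a)) \<partial>?PI)" for a
  have [measurable]: "H \<in> borel_measurable borel"
    using measurable_compose[OF measurable_fun_upd_borel[of i I T] h[unfolded N]]
    unfolding H_def by (intro PI.borel_measurable_nn_integral) (simp add: case_prod_beta')
  have "(\<integral>\<^sup>+ v. h (thermalize (i, \<theta>, w) v) \<partial>gaussian_product T N) =
      (\<integral>\<^sup>+ a. H (a * cos \<theta> - w * sin \<theta>) \<partial>gaussian T)" for w
    by (subst split[OF measurable_compose[OF _ h]]) (measurable, simp add: H_def thermalize_def)
  then have "(\<integral>\<^sup>+ w. \<integral>\<^sup>+ v. h (thermalize (i, \<theta>, w) v) \<partial>gaussian_product T N \<partial>gaussian T) =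
      (\<integral>\<^sup>+ w. \<integral>\<^sup>+ a. H (a * cos \<theta> - w * sin \<theta>) \<partial>gaussian T \<partial>gaussian T)"
    by simp
  \<comment> \<open>The exchange puts the particle velocity first, as in the rotation lemma, which
    is then applied to a function of the first coordinate alone.\<close>
  also have "\<dots> = (\<integral>\<^sup>+ a. \<integral>\<^sup>+ w. H (a * cos \<theta> - w * sin \<theta>) \<partial>gaussian T \<partial>gaussian T)"
    by (rule GG.Fubini') measurable
  also have "\<dots> = (\<integral>\<^sup>+ a. \<integral>\<^sup>+ w. H a \<partial>gaussian T \<partial>gaussian T)"
    by (rule nn_integral_gaussian_rotation[OF T, where f = "\<lambda>x y. H x"]) auto
  also have "\<dots> = (\<integral>\<^sup>+ v. h v \<partial>gaussian_product T N)"
    unfolding split[OF h] by (simp add: G.emeasure_space_1 H_def)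
  finally show ?thesis .
qed

text \<open>Each kind of jump preserves the law separately, so any mixture of the two does.\<close>

lemma kac_step_gaussian_product:
  assumes params: "lam > 0" "\<mu> > 0" "T > 0" "N \<ge> 2"
  shows "kac_step lam \<mu> T N (gaussian_product T N) = gaussian_product T N"
proof -
  let ?g = "gaussian_product T N"
  interpret g: prob_space ?g using params(3) by (rule prob_space_PiM_gaussian)
  interpret C: prob_space "collision_noise N" using params(4) by (rule prob_space_collision_noise)
  interpret A: prob_space angle by (rule prob_space_angle)
  interpret G: prob_space "gaussian T" using params(3) by (rule prob_space_gaussian)
  interpret AG: pair_prob_space angle "gaussian T" ..
  interpret T: prob_space "thermostat_noise T N" using params by (intro prob_space_thermostat_noise) auto
  have [measurable_cong]: "sets ?g = sets (euclid N)" by (rule sets_gaussian_product)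
  note [measurable] = measurable_collide measurable_thermalize
  have step: "emeasure (random_step U (euclid N) F ?g) B =
      (\<integral>\<^sup>+ u. \<integral>\<^sup>+ v. indicator B (F u v) \<partial>?g \<partial>U)"
    if [measurable]: "(\<lambda>(u, v). F u v) \<in> measurable (U \<Otimes>\<^sub>M euclid N) (euclid N)" "B \<in> sets (euclid N)"
    for U :: "'u measure" and F B
  proof -
    have "emeasure (random_step U (euclid N) F ?g) B =
        (\<integral>\<^sup>+ v. indicator B v \<partial>random_step U (euclid N) F ?g)"
      by (simp add: random_step_def)
    also have "\<dots> = (\<integral>\<^sup>+ z. indicator B (case z of (u, v) \<Rightarrow> F u v) \<partial>(U \<Otimes>\<^sub>M ?g))"
      unfolding random_step_def by (rule nn_integral_distr) simp_all
    also have "\<dots> = (\<integral>\<^sup>+ u. \<integral>\<^sup>+ v. indicator B (F u v) \<partial>?g \<partial>U)"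
      by (subst g.nn_integral_fst[symmetric]) (simp_all add: case_prod_beta')
    finally show ?thesis .
  qed
  have invC: "random_step (collision_noise N) (euclid N) collide ?g = ?g"
  proof (rule measure_eqI)
    fix B assume "B \<in> sets (random_step (collision_noise N) (euclid N) collide ?g)"
    then have B[measurable]: "B \<in> sets (euclid N)" by (simp add: random_step_def)
    have "(\<integral>\<^sup>+ u. \<integral>\<^sup>+ v. indicator B (collide u v) \<partial>?g \<partial>collision_noise N) =
        (\<integral>\<^sup>+ u. \<integral>\<^sup>+ v. indicator B v \<partial>?g \<partial>collision_noise N)"
    proof (rule nn_integral_cong, clarify)
      fix i j \<theta> assume "((i, j), \<theta>) \<in> space (collision_noise N)"
      then have "(i, j) \<in> ordered_pairs N"
        by (simp add: collision_noise_def space_pair_measure space_uniform_count_measure)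
      then show "(\<integral>\<^sup>+ v. indicator B (collide ((i, j), \<theta>) v) \<partial>?g) = (\<integral>\<^sup>+ v. indicator B v \<partial>?g)"
        using params(3) by (intro nn_integral_collide_gaussian_product) auto
    qed
    then show "emeasure (random_step (collision_noise N) (euclid N) collide ?g) B = emeasure ?g B"
      by (simp add: step C.emeasure_space_1 sets_gaussian_product)
  qed (simp add: random_step_def sets_gaussian_product)
  have invT: "random_step (thermostat_noise T N) (euclid N) thermalize ?g = ?g"
  proof (rule measure_eqI)
    fix B assume "B \<in> sets (random_step (thermostat_noise T N) (euclid N) thermalize ?g)"
    then have B[measurable]: "B \<in> sets (euclid N)" by (simp add: random_step_def)
    have m: "(\<lambda>u. \<integral>\<^sup>+ v. indicator B (thermalize u v) \<partial>?g) \<in> borel_measurable (thermostat_noise T N)"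
      by (intro g.borel_measurable_nn_integral) measurable
    \<comment> \<open>The noise integrals are ordered as index, angle, \<open>w\<close>, so that the
      integral over \<open>w\<close> is innermost, where the invariance for a fixed index and angle
      applies.\<close>
    have "(\<integral>\<^sup>+ u. \<integral>\<^sup>+ v. indicator B (thermalize u v) \<partial>?g \<partial>thermostat_noise T N) =
        (\<integral>\<^sup>+ i. \<integral>\<^sup>+ y. \<integral>\<^sup>+ v. indicator B (thermalize (i, y) v) \<partial>?g \<partial>(angle \<Otimes>\<^sub>M gaussian T) \<partial>uniform_count_measure {..<N})"
      using m unfolding thermostat_noise_def by (rule AG.P.nn_integral_fst[symmetric])
    also have "\<dots> = (\<integral>\<^sup>+ i. emeasure ?g B \<partial>uniform_count_measure {..<N})"
    proof (rule nn_integral_cong)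
      fix i assume i: "i \<in> space (uniform_count_measure {..<N})"
      then have "(\<lambda>y. \<integral>\<^sup>+ v. indicator B (thermalize (i, y) v) \<partial>?g) \<in> borel_measurable (angle \<Otimes>\<^sub>M gaussian T)"
        using m unfolding thermostat_noise_def by (auto dest: measurable_Pair2)
      from G.nn_integral_fst[OF this, symmetric]
      show "(\<integral>\<^sup>+ y. \<integral>\<^sup>+ v. indicator B (thermalize (i, y) v) \<partial>?g \<partial>(angle \<Otimes>\<^sub>M gaussian T)) = emeasure ?g B"
        using i params(3)
        by (simp add: nn_integral_thermalize_gaussian_product space_uniform_count_measure
            A.emeasure_space_1 sets_gaussian_product)
    qed
    also have "\<dots> = emeasure ?g B"
      using prob_space.emeasure_space_1[OF prob_space_uniform_count_measure[of "{..<N}"]] params(4)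
      by (simp add: lessThan_empty_iff)
    finally show "emeasure (random_step (thermostat_noise T N) (euclid N) thermalize ?g) B = emeasure ?g B"
      by (simp add: step)
  qed (simp add: random_step_def sets_gaussian_product)
  show ?thesis
    unfolding kac_step_def invC invT if_cancel
    by (rule bind_const'[OF prob_space_measure_pmf g.subprob_space_axioms])
qed


section \<open>Contraction in continuous time\<close>

text \<open>A single Bernoulli draw selects the kind of jump for both copies.\<close>

definition coupled_kac_step ::
    "real \<Rightarrow> real \<Rightarrow> real \<Rightarrow> nat \<Rightarrow> ((nat \<Rightarrow> real) \<times> (nat \<Rightarrow> real)) measure \<Rightarrow>
      ((nat \<Rightarrow> real) \<times> (nat \<Rightarrow> real)) measure" where
  "coupled_kac_step lam \<mu> T N P = measure_pmf (bernoulli_pmf (lam / (lam + \<mu>))) \<bind>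
     (\<lambda>b. if b then synchronous_step (collision_noise N) (euclid N) collide P
          else synchronous_step (thermostat_noise T N) (euclid N) thermalize P)"

text \<open>The mean of the factor 1 for a collision and \<open>1 - 1 / (2 * N)\<close> for a
  thermostat jump, which has probability \<open>\<mu> / (lam + \<mu>)\<close>.\<close>

definition contraction :: "real \<Rightarrow> real \<Rightarrow> nat \<Rightarrow> real" where
  "contraction lam \<mu> N = 1 - \<mu> / (2 * real N * (lam + \<mu>))"

text \<open>The cost identity holds for every coupling and not just for an optimal one, so the step
  can be iterated without choosing a new coupling after each jump.\<close>

lemma coupled_kac_step:
  assumes params: "lam > 0" "\<mu> > 0" "T > 0" "N \<ge> 2" and P: "P \<in> couplings N f g"
  shows "coupled_kac_step lam \<mu> T N P \<in> couplings N (kac_step lam \<mu> T N f) (kac_step lam \<mu> T N g)"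
    and "transport_cost N (coupled_kac_step lam \<mu> T N P) = ennreal (contraction lam \<mu> N) * transport_cost N P"
proof -
  let ?p = "lam / (lam + \<mu>)"
  have p: "0 \<le> ?p" "?p \<le> 1" using params by auto
  have N: "N \<ge> 1" using params by simp
  have c: "(if b then synchronous_step (collision_noise N) (euclid N) collide P
          else synchronous_step (thermostat_noise T N) (euclid N) thermalize P) \<in>
      couplings N (if b then random_step (collision_noise N) (euclid N) collide f
          else random_step (thermostat_noise T N) (euclid N) thermalize f)
        (if b then random_step (collision_noise N) (euclid N) collide g
          else random_step (thermostat_noise T N) (euclid N) thermalize g)" for b
    using synchronous_step_couplings[OF prob_space_collision_noise[OF params(4)] P measurable_collide]
      synchronous_step_couplings[OF prob_space_thermostat_noise[OF N params(3)] P measurable_thermalize]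
    by simp
  show "coupled_kac_step lam \<mu> T N P \<in> couplings N (kac_step lam \<mu> T N f) (kac_step lam \<mu> T N g)"
    unfolding coupled_kac_step_def kac_step_def by (rule bind_pmf_couplings[OF c])
  have "transport_cost N (coupled_kac_step lam \<mu> T N P) =
      transport_cost N P * ?p + ennreal (1 - 1 / (2 * real N)) * transport_cost N P * (1 - ?p)"
    unfolding coupled_kac_step_def using p
    by (subst transport_cost_bind_pmf[OF c])
      (simp add: transport_cost_collide[OF P params(4)] transport_cost_thermalize[OF P N params(3)])
  also have "\<dots> = (ennreal ?p + ennreal (1 - 1 / (2 * real N)) * ennreal (1 - ?p)) * transport_cost N P"
    by (simp add: algebra_simps)
  also have "ennreal ?p + ennreal (1 - 1 / (2 * real N)) * ennreal (1 - ?p) =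
      ennreal (?p + (1 - 1 / (2 * real N)) * (1 - ?p))"
    using p N by (subst ennreal_mult[symmetric], simp, simp, subst ennreal_plus) auto
  also have "?p + (1 - 1 / (2 * real N)) * (1 - ?p) = contraction lam \<mu> N"
  proof -
    have "1 - ?p = \<mu> / (lam + \<mu>)"
      using params by (simp add: field_simps)
    moreover have "?p + (1 - 1 / (2 * real N)) * (1 - ?p) = 1 - 1 / (2 * real N) * (1 - ?p)"
      by (simp add: algebra_simps)
    ultimately show ?thesis
      by (simp add: contraction_def)
  qed
  finally show "transport_cost N (coupled_kac_step lam \<mu> T N P) =
      ennreal (contraction lam \<mu> N) * transport_cost N P" .
qed

text \<open>An initial coupling evolved through \<open>n\<close> coupled jumps has its cost
  multiplied by the \<open>n\<close>-th power of the contraction factor, and the Poisson average of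
  these powers is the generating function. The sequences \<open>f\<close> and \<open>g\<close> are
  abstract so that a constant sequence at an invariant law is covered as well.\<close>

lemma poisson_mixture_W2:
  assumes params: "lam > 0" "\<mu> > 0" "T > 0" "N \<ge> 2" and "t > 0"
    and f: "\<And>n. f (Suc n) = kac_step lam \<mu> T N (f n)" and g: "\<And>n. g (Suc n) = kac_step lam \<mu> T N (g n)"
  defines "p \<equiv> measure_pmf (poisson_pmf ((lam + \<mu>) * real N * t))"
  shows "(W2 N (p \<bind> f) (p \<bind> g))\<^sup>2 \<le> ennreal (exp (- (\<mu> / 2) * t)) * (W2 N (f 0) (g 0))\<^sup>2"
proof -
  define s where "s = (lam + \<mu>) * real N * t"
  have s: "s > 0" using params \<open>t > 0\<close> by (simp add: s_def)
  let ?a = "contraction lam \<mu> N" and ?e = "exp (- (\<mu> / 2) * t)"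
  have a: "0 \<le> ?a"
  proof -
    have "\<mu> / (2 * real N * (lam + \<mu>)) \<le> 1"
    proof (subst divide_le_eq_1_pos)
      show "0 < 2 * real N * (lam + \<mu>)" using params by simp
      have "\<mu> \<le> 1 * (lam + \<mu>)" using params by simp
      also have "\<dots> \<le> 2 * real N * (lam + \<mu>)" using params by (intro mult_right_mono) auto
      finally show "\<mu> \<le> 2 * real N * (lam + \<mu>)" .
    qed
    then show ?thesis by (simp add: contraction_def)
  qed
  \<comment> \<open>One minus the contraction factor is
    \<open>\<mu> / (2 * N * (lam + \<mu>))\<close>; the mean number of jumps \<open>s\<close>
    cancels all of it but \<open>\<mu> / 2\<close> and contributes \<open>t\<close>.\<close>
  have decay: "- s * (1 - ?a) = - (\<mu> / 2) * t"
  proof -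
    have "lam + \<mu> \<noteq> 0" "real N \<noteq> 0" using params by auto
    then show ?thesis by (simp add: s_def contraction_def)
  qed
  have bound: "(W2 N (p \<bind> f) (p \<bind> g))\<^sup>2 \<le> ennreal ?e * transport_cost N P0"
    if P0: "P0 \<in> couplings N (f 0) (g 0)" for P0
  proof -
    define P where "P n = (coupled_kac_step lam \<mu> T N ^^ n) P0" for n
    have P: "P n \<in> couplings N (f n) (g n) \<and> transport_cost N (P n) = ennreal (?a ^ n) * transport_cost N P0" for n
    proof (induction n)
      case (Suc n)
      then show ?case
        using coupled_kac_step[OF params, of "P n" "f n" "g n"] a
        by (simp add: P_def f g ennreal_mult mult.assoc)
    qed (simp add: P_def P0)
    \<comment> \<open>The two copies also share the number of jumps, so mixing the couplings
      \<open>P n\<close> is an admissible coupling of the two mixtures.\<close>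
    have "(W2 N (p \<bind> f) (p \<bind> g))\<^sup>2 \<le> transport_cost N (p \<bind> P)"
      unfolding W2_square p_def using P by (intro INF_lower bind_pmf_couplings) auto
    also have "\<dots> = (\<integral>\<^sup>+ n. ennreal (?a ^ n) * transport_cost N P0 \<partial>p)"
      unfolding p_def using P by (subst transport_cost_bind_pmf[where f = f and g = g]) auto
    also have "\<dots> = (\<integral>\<^sup>+ n. ennreal (?a ^ n) \<partial>p) * transport_cost N P0"
      by (rule nn_integral_multc) (simp add: p_def)
    also have "(\<integral>\<^sup>+ n. ennreal (?a ^ n) \<partial>p) = (\<Sum>n. ennreal (poisson_weight s n) * ennreal (?a ^ n))"
      using s unfolding p_def s_def[symmetric]
      by (simp add: nn_integral_measure_pmf nn_integral_count_space_nat poisson_weight_def)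
    also have "\<dots> = (\<Sum>n. ennreal (poisson_weight s n * ?a ^ n))"
      using s a by (intro suminf_cong ennreal_mult[symmetric] poisson_weight_nonneg) auto
    also have "\<dots> = ennreal (exp (- s * (1 - ?a)))"
      using poisson_weight_generating[of s ?a] poisson_weight_nonneg[of s] s a
      by (subst suminf_ennreal2) (auto simp: sums_iff)
    finally show ?thesis
      unfolding decay .
  qed
  \<comment> \<open>The exponential factor is moved to the other side before the infimum over
    \<open>P0\<close> is taken, and back afterwards; this avoids exchanging a product with an
    infimum in \<open>[0, \<infinity>]\<close>.\<close>
  have cancel: "ennreal (exp (\<mu> / 2 * t)) * (ennreal ?e * x) = x"
    "ennreal ?e * (ennreal (exp (\<mu> / 2 * t)) * x) = x" for x
    by (simp_all add: mult.assoc[symmetric] ennreal_mult[symmetric] exp_add[symmetric])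
  have "ennreal (exp (\<mu> / 2 * t)) * (W2 N (p \<bind> f) (p \<bind> g))\<^sup>2 \<le> (W2 N (f 0) (g 0))\<^sup>2"
    unfolding W2_square[of N "f 0"]
  proof (rule INF_greatest)
    fix P0 assume "P0 \<in> couplings N (f 0) (g 0)"
    from mult_left_mono[OF bound[OF this], of "ennreal (exp (\<mu> / 2 * t))"]
    show "ennreal (exp (\<mu> / 2 * t)) * (W2 N (p \<bind> f) (p \<bind> g))\<^sup>2 \<le> transport_cost N P0"
      unfolding cancel by simp
  qed
  from mult_left_mono[OF this, of "ennreal ?e"] show ?thesis
    unfolding cancel by simp
qed

text \<open>This reduces the process to the sequence of laws of its jump chain, with total rate
  \<open>(lam + \<mu>) * N\<close>. Time 0 is stated apart because the Poisson law is used with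
  positive mean.\<close>

lemma kac_system_poisson_mixture:
  assumes params: "lam > 0" "\<mu> > 0" "T > 0" "N \<ge> 2"
    and V: "thermostated_kac_system lam \<mu> T N M V"
  obtains f where "f 0 = distr M (euclid N) (V 0)" "\<And>n. f (Suc n) = kac_step lam \<mu> T N (f n)"
    "\<And>t. t > 0 \<Longrightarrow> distr M (euclid N) (V t) = measure_pmf (poisson_pmf ((lam + \<mu>) * real N * t)) \<bind> f"
proof -
  let ?c = "(lam + \<mu>) * real N"
  have c: "?c > 0" using params by simp
  have jump: "pure_jump_markov_process M (euclid N) (kac_rate lam \<mu> T N) V"
    using V by (simp add: thermostated_kac_system_def)
  then interpret prob_space M by (simp add: pure_jump_markov_process_def)
  obtain Y where Y: "markov_chain M (euclid N)
      (\<lambda>x B. kac_rate lam \<mu> T N x B / kac_rate lam \<mu> T N x (space (euclid N))) Y"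
    and law: "\<And>t B. 0 \<le> t \<Longrightarrow> B \<in> sets (euclid N) \<Longrightarrow> emeasure (distr M (euclid N) (V t)) B =
          (\<Sum>n. ennreal (poisson_weight (?c * t) n) * emeasure (distr M (euclid N) (Y n)) B)"
    using pure_jump_marginal[OF jump c] kac_rate_total[OF params(4,3)] by blast
  have Ym: "Y n \<in> measurable M (euclid N)" for n
    using Y by (simp add: markov_chain_def)
  define f where "f n = distr M (euclid N) (Y n)" for n
  have f: "f n \<in> space (prob_algebra (euclid N))" for n
    using prob_space_distr[OF Ym] by (simp add: f_def space_prob_algebra)
  show ?thesis
  proof (rule that)
    \<comment> \<open>At time 0 only the weight at \<open>n = 0\<close> survives, and it is 1
      because \<open>0 ^ 0 = 1\<close>.\<close>
    show "f 0 = distr M (euclid N) (V 0)"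
    proof (rule measure_eqI)
      fix B assume "B \<in> sets (f 0)"
      then have "emeasure (distr M (euclid N) (V 0)) B =
          (\<Sum>n. ennreal (poisson_weight (?c * 0) n) * emeasure (f n) B)"
        unfolding f_def by (intro law) auto
      also have "\<dots> = (\<Sum>n\<in>{0}. ennreal (poisson_weight (?c * 0) n) * emeasure (f n) B)"
        by (rule suminf_finite) (auto simp: poisson_weight_def)
      finally show "emeasure (f 0) B = emeasure (distr M (euclid N) (V 0)) B"
        by (simp add: poisson_weight_def)
    qed (simp add: f_def)
    show "f (Suc n) = kac_step lam \<mu> T N (f n)" for n
      unfolding f_def by (rule markov_chain_kac_step[OF params prob_space_axioms Y])
    show "distr M (euclid N) (V t) = measure_pmf (poisson_pmf (?c * t)) \<bind> f" if t: "t > 0" for t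
    proof (rule measure_eqI)
      show "sets (distr M (euclid N) (V t)) = sets (measure_pmf (poisson_pmf (?c * t)) \<bind> f)"
        unfolding sets_bind_measure_pmf[OF f] by simp
      fix B assume "B \<in> sets (distr M (euclid N) (V t))"
      then have B: "B \<in> sets (euclid N)" by simp
      have "0 < ?c * t" using c t by simp
      then show "emeasure (distr M (euclid N) (V t)) B = emeasure (measure_pmf (poisson_pmf (?c * t)) \<bind> f) B"
        unfolding emeasure_bind_measure_pmf[OF f B] law[OF less_imp_le[OF t] B]
        by (simp add: nn_integral_measure_pmf nn_integral_count_space_nat poisson_weight_def f_def)
    qed
  qed
qed

theorem lemma7:
  fixes lam \<mu> T :: real and N :: nat
    and M :: "'a measure" and V :: "real \<Rightarrow> 'a \<Rightarrow> nat \<Rightarrow> real"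
  assumes "lam > 0" and "\<mu> > 0" and "T > 0" and "N \<ge> 2"
    and "thermostated_kac_system lam \<mu> T N M V"
    and "symmetric_law N (distr M (euclid N) (V 0))"
  shows
    "(\<forall>(M' :: 'b measure) V'.
        thermostated_kac_system lam \<mu> T N M' V' \<longrightarrow>
        symmetric_law N (distr M' (euclid N) (V' 0)) \<longrightarrow>
        (\<forall>t\<ge>0. (W2 N (distr M (euclid N) (V t)) (distr M' (euclid N) (V' t)))\<^sup>2
          \<le> ennreal (exp (- (\<mu> / 2) * t)) *
             (W2 N (distr M (euclid N) (V 0)) (distr M' (euclid N) (V' 0)))\<^sup>2)) \<and>
     (\<forall>t\<ge>0. (W2 N (distr M (euclid N) (V t)) (PiM {..<N} (\<lambda>_. gaussian T)))\<^sup>2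
          \<le> ennreal (exp (- (\<mu> / 2) * t)) *
             (W2 N (distr M (euclid N) (V 0)) (PiM {..<N} (\<lambda>_. gaussian T)))\<^sup>2)"
proof -
  note params = assms(1-4)
  \<comment> \<open>From here on only laws matter: the processes may live on different probability
    spaces, since the coupling is built from the laws of their jump chains.\<close>
  obtain f where f: "f 0 = distr M (euclid N) (V 0)" "\<And>n. f (Suc n) = kac_step lam \<mu> T N (f n)"
    "\<And>t. t > 0 \<Longrightarrow> distr M (euclid N) (V t) = measure_pmf (poisson_pmf ((lam + \<mu>) * real N * t)) \<bind> f"
    using kac_system_poisson_mixture[OF params assms(5)] by blast
  show ?thesis
  proof (intro conjI allI impI)
    fix M' :: "'b measure" and V' t
    assume "thermostated_kac_system lam \<mu> T N M' V'" and t: "0 \<le> (t :: real)"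
    then obtain g where g: "g 0 = distr M' (euclid N) (V' 0)" "\<And>n. g (Suc n) = kac_step lam \<mu> T N (g n)"
      "\<And>t. t > 0 \<Longrightarrow> distr M' (euclid N) (V' t) = measure_pmf (poisson_pmf ((lam + \<mu>) * real N * t)) \<bind> g"
      using kac_system_poisson_mixture[OF params] by blast
    show "(W2 N (distr M (euclid N) (V t)) (distr M' (euclid N) (V' t)))\<^sup>2
          \<le> ennreal (exp (- (\<mu> / 2) * t)) *
             (W2 N (distr M (euclid N) (V 0)) (distr M' (euclid N) (V' 0)))\<^sup>2"
    proof (cases "t = 0")
      case False
      then show ?thesis
        using poisson_mixture_W2[OF params, of t f g] t by (simp add: f g)
    qed simp
  next
    fix t :: real assume t: "0 \<le> t"
    \<comment> \<open>The Gaussian product law enters as a constant sequence: fixed by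
      \<open>kac_step\<close> and unchanged by mixing, it plays the part of the second
      system.\<close>
    have const: "measure_pmf p \<bind> (\<lambda>n. gaussian_product T N) = gaussian_product T N" for p :: "nat pmf"
      using prob_space_PiM_gaussian[OF params(3)]
      by (intro bind_const' prob_space_measure_pmf prob_space_imp_subprob_space)
    show "(W2 N (distr M (euclid N) (V t)) (gaussian_product T N))\<^sup>2
          \<le> ennreal (exp (- (\<mu> / 2) * t)) *
             (W2 N (distr M (euclid N) (V 0)) (gaussian_product T N))\<^sup>2"
    proof (cases "t = 0")
      case False
      then show ?thesis
        using poisson_mixture_W2[OF params, of t f "\<lambda>_. gaussian_product T N"] t
        by (simp add: f const kac_step_gaussian_product[OF params])
    qed simp
  qed
qed

end
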